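(* Let the plant $\dot x=f(x,u)$ with steady-state map $h:\mathbb{R}^p\to\mathbb{R}^n$ satisfy the Plant Assumption. Let $\Phi:\mathbb{R}^n\times\mathbb{R}^p\to\mathbb{R}$ be continuously differentiable with locally Lipschitz gradient, let $Q:\mathbb{R}^p\to\mathbb{S}^p_+$ be locally Lipschitz, and let $L>0$ be such that $$\left\| H(u)^T\left(\nabla\Phi(x',u)^T-\nabla\Phi(x,u)^T\right)\right\|\le L\|x'-x\|\qquad\text{for all } x,x'\in\mathbb{R}^n,\ u\in\mathbb{R}^p .$$ Let $W:\mathbb{R}^n\times\mathbb{R}^p\to\mathbb{R}$ be a Lyapunov function for the plant with constants $\alpha,\beta,\gamma,\zeta>0$ as defined in the context. Suppose that $\tilde\Phi(u):=\Phi(h(u),u)$ has compact level sets and that $$\sup_{u\in\mathbb{R}^p}\|Q(u)\|<\frac{\gamma}{\zeta L}.$$ Then all trajectories of the interconnected system $$\dot x=f(x,u),\qquad \dot u=-Q(u)H(u)^T\,\nabla\Phi(x,u)^T$$ are complete and converge to the set of first-order optimal (critical) points of the problem $$\min_{x,u}\ \Phi(x,u)\quad\text{subject to}\quad x=h(u).$$ Furthermore, every asymptotically stable equilibrium point of the interconnected system is a strict local minimizer of this problem, and every strict local minimizer of this problem is a stable equilibrium of the interconnected system.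
   Context: Notation: $\nabla$ denotes the Jacobian (a row vector for scalar functions), so $\nabla\Phi(x,u)^T\in\mathbb{R}^{n+p}$ is the gradient of $\Phi$ with respect to $(x,u)$. $\|\cdot\|$ is the Euclidean norm or the induced matrix norm. $\mathbb{S}^p_+$ is the set of symmetric positive definite $p\times p$ matrices. $H(u)^T:=\begin{bmatrix}\nabla h(u)^T & I_p\end{bmatrix}\in\mathbb{R}^{p\times(n+p)}$. A function $V$ has compact level sets if $\{u: V(u)\le c\}$ is compact for every $c\in\mathbb{R}$. Plant Assumption: $f:\mathbb{R}^n\times\mathbb{R}^p\to\mathbb{R}^n$ is continuously differentiable, $\ell_x$-Lipschitz in $x$ and $\ell_u$-Lipschitz in $u$. The map $h:\mathbb{R}^p\to\mathbb{R}^n$ is continuously differentiable, $\ell$-Lipschitz, and satisfies $f(h(u),u)=0$ for all $u\in\mathbb{R}^p$. There exist $\tau,K>0$ such that for every $x_0\in\mathbb{R}^n$ and every constant $\hat u\in\mathbb{R}^p$ the solution of $\dot x=f(x,\hat u)$, $x(0)=x_0$, satisfies $\|x(t)-h(\hat u)\|\le K\|x_0-h(\hat u)\|e^{-\tau t}$ for all $t\ge 0$. Lyapunov function $W$ with constants $\alpha,\beta,\gamma,\zeta>0$: $W$ is differentiable and for all $(x,u)$: $\alpha\|x-h(u)\|^2\le W(x,u)\le\beta\|x-h(u)\|^2$, $\ \nabla_xW(x,u)f(x,u)\le-\gamma\|x-h(u)\|^2$, $\ \|\nabla_uW(x,u)\|\le\zeta\|x-h(u)\|$. Critical (first-order optimal)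 point of $\min\{\Phi(x,u)\mid x=h(u)\}$: a point $(x^\star,u^\star)$ with $x^\star=h(u^\star)$ for which there is $\lambda\in\mathbb{R}^n$ with $\nabla\Phi(x^\star,u^\star)^T+\begin{bmatrix}I_n\\-\nabla h(u^\star)^T\end{bmatrix}\lambda=0$. A feasible point is a strict local minimizer if it has strictly smaller cost than all other feasible points in some neighborhood of it. A trajectory is complete if it is defined for all $t\ge0$; stability and asymptotic stability are in the sense of Lyapunov. *)

theory Defs
  imports "HOL-Analysis.Analysis"
begin

section \<open>Calculus\<close>

definition gradient :: "('a::euclidean_space \<Rightarrow> real) \<Rightarrow> 'a \<Rightarrow> 'a" where
  "gradient g z = (THE D. GDERIV g z :> D)"

lemma GDERIV_gradient:
  fixes g :: "'a::euclidean_space \<Rightarrow> real"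
  assumes "g differentiable (at z)"
  shows "GDERIV g z :> gradient g z"
proof -
  obtain g' where g': "(g has_derivative g') (at z)"
    using assms by (auto simp: differentiable_def)
  then have "bounded_linear g'" by (rule has_derivative_bounded_linear)
  then have lin: "linear g'" by (rule bounded_linear.linear)
  define D where "D = adjoint g' 1"
  have "g' v = v \<bullet> D" for v
    unfolding D_def using adjoint_works[OF lin, of v "1::real"] by simp
  then have "g' = (\<lambda>v. v \<bullet> D)" by auto
  with g' have D: "GDERIV g z :> D" by (simp add: gderiv_def)
  show ?thesis unfolding gradient_def
  proof (rule theI[of _ D])
    fix E assume "GDERIV g z :> E"
    with D have "(\<lambda>v. v \<bullet> E) = (\<lambda>v. v \<bullet> D)"
      unfolding gderiv_def by (rule has_derivative_unique[rotated])
    then have "v \<bullet> E = v \<bullet> D" for v by (rule fun_cong)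
    then show "E = D" by (metis vector_eq_ldot)
  qed (rule D)
qed

definition C1 :: "('a::real_normed_vector \<Rightarrow> 'b::real_normed_vector) \<Rightarrow> bool" where
  "C1 g \<longleftrightarrow> (\<exists>g' :: 'a \<Rightarrow> 'a \<Rightarrow>\<^sub>L 'b.
     (\<forall>z. (g has_derivative blinfun_apply (g' z)) (at z)) \<and> continuous_on UNIV g')"

definition locally_lipschitz :: "('a::metric_space \<Rightarrow> 'b::metric_space) \<Rightarrow> bool" where
  "locally_lipschitz g \<longleftrightarrow> (\<forall>z. \<exists>e>0. \<exists>M. M-lipschitz_on (cball z e) g)"

definition sym_posdef :: "real^'p^'p \<Rightarrow> bool" where
  "sym_posdef A \<longleftrightarrow> transpose A = A \<and> (\<forall>v. v \<noteq> 0 \<longrightarrow> v \<bullet> (A *v v) > 0)"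

text \<open>The library norm on \<^typ>\<open>real^'p^'p\<close> is the Frobenius norm, not the induced one.\<close>

definition matrix_norm :: "real^'p^'p \<Rightarrow> real" where
  "matrix_norm A = onorm ((*v) A)"

definition compact_level_sets :: "('a::topological_space \<Rightarrow> real) \<Rightarrow> bool" where
  "compact_level_sets V \<longleftrightarrow> (\<forall>c. compact {u. V u \<le> c})"


section \<open>Autonomous differential equations\<close>

text \<open>Solutions start at time 0. The degenerate domain \<open>{0}\<close> is admitted, so that a point from
  which no solution can be continued in forward time carries a maximal solution with domain
  \<open>{0}\<close>; completeness of all maximal solutions therefore includes existence.
  Solutions are not required to be unique.\<close>

definition ode_solution :: "('a::real_normed_vector \<Rightarrow> 'a) \<Rightarrow> (real \<Rightarrow> 'a) \<Rightarrow> real set \<Rightarrow> bool" where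
  "ode_solution F z J \<longleftrightarrow> is_interval J \<and> 0 \<in> J \<and> J \<subseteq> {0..} \<and>
     (\<forall>t\<in>J. (z has_vector_derivative F (z t)) (at t within J))"

definition trajectory :: "('a::real_normed_vector \<Rightarrow> 'a) \<Rightarrow> (real \<Rightarrow> 'a) \<Rightarrow> real set \<Rightarrow> bool" where
  "trajectory F z J \<longleftrightarrow> ode_solution F z J \<and>
     (\<forall>y J'. ode_solution F y J' \<and> J \<subseteq> J' \<and> (\<forall>t\<in>J. y t = z t) \<longrightarrow> J' = J)"

text \<open>Stated with a witness in \<open>C\<close> because \<^const>\<open>infdist\<close> to the empty set is 0.\<close>

definition converges_to_set :: "(real \<Rightarrow> 'a::metric_space) \<Rightarrow> 'a set \<Rightarrow> bool" where
  "converges_to_set z C \<longleftrightarrow> (\<forall>e>0. \<forall>\<^sub>F t in at_top. \<exists>c\<in>C. dist (z t) c < e)"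

definition stable_equilibrium :: "('a::real_normed_vector \<Rightarrow> 'a) \<Rightarrow> 'a \<Rightarrow> bool" where
  "stable_equilibrium F ze \<longleftrightarrow> F ze = 0 \<and>
     (\<forall>e>0. \<exists>d>0. \<forall>z J. trajectory F z J \<and> dist (z 0) ze < d \<longrightarrow> (\<forall>t\<in>J. dist (z t) ze < e))"

definition asymptotically_stable_equilibrium :: "('a::real_normed_vector \<Rightarrow> 'a) \<Rightarrow> 'a \<Rightarrow> bool" where
  "asymptotically_stable_equilibrium F ze \<longleftrightarrow> stable_equilibrium F ze \<and>
     (\<exists>d>0. \<forall>z J. trajectory F z J \<and> dist (z 0) ze < d \<longrightarrow> J = {0..} \<and> (z \<longlongrightarrow> ze) at_top)"


section \<open>Plant and feedback interconnection\<close>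

definition plant_assumption ::
  "((real^'n) \<times> (real^'p) \<Rightarrow> real^'n) \<Rightarrow> (real^'p \<Rightarrow> real^'n) \<Rightarrow> real \<Rightarrow> real \<Rightarrow> real \<Rightarrow> bool" where
  "plant_assumption f h lx lu l \<longleftrightarrow>
     C1 f \<and> (\<forall>u. lx-lipschitz_on UNIV (\<lambda>x. f (x, u))) \<and> (\<forall>x. lu-lipschitz_on UNIV (\<lambda>u. f (x, u))) \<and>
     C1 h \<and> l-lipschitz_on UNIV h \<and> (\<forall>u. f (h u, u) = 0) \<and>
     (\<exists>\<tau>>0. \<exists>K>0. \<forall>u x. ode_solution (\<lambda>y. f (y, u)) x {0..} \<longrightarrow>
        (\<forall>t\<ge>0. norm (x t - h u) \<le> K * norm (x 0 - h u) * exp (- \<tau> * t)))"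

definition plant_lyapunov ::
  "((real^'n) \<times> (real^'p) \<Rightarrow> real^'n) \<Rightarrow> (real^'p \<Rightarrow> real^'n) \<Rightarrow>
   ((real^'n) \<times> (real^'p) \<Rightarrow> real) \<Rightarrow> real \<Rightarrow> real \<Rightarrow> real \<Rightarrow> real \<Rightarrow> bool" where
  "plant_lyapunov f h W \<alpha> \<beta> \<gamma> \<zeta> \<longleftrightarrow>
     \<alpha> > 0 \<and> \<beta> > 0 \<and> \<gamma> > 0 \<and> \<zeta> > 0 \<and> (\<forall>z. W differentiable (at z)) \<and>
     (\<forall>x u. \<alpha> * (norm (x - h u))\<^sup>2 \<le> W (x, u) \<and> W (x, u) \<le> \<beta> * (norm (x - h u))\<^sup>2 \<and>
        fst (gradient W (x, u)) \<bullet> f (x, u) \<le> - \<gamma> * (norm (x - h u))\<^sup>2 \<and>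
        norm (snd (gradient W (x, u))) \<le> \<zeta> * norm (x - h u))"

text \<open>The block matrix \<open>H(u)\<^sup>T = [\<nabla>h(u)\<^sup>T  I]\<close>, acting on
  \<open>(v, w)\<close> in the product space.\<close>

definition HT :: "(real^'p \<Rightarrow> real^'n) \<Rightarrow> real^'p \<Rightarrow> (real^'n) \<times> (real^'p) \<Rightarrow> real^'p" where
  "HT h u = (\<lambda>(v, w). transpose (jacobian h (at u)) *v v + w)"

definition closed_loop ::
  "((real^'n) \<times> (real^'p) \<Rightarrow> real^'n) \<Rightarrow> (real^'p \<Rightarrow> real^'n) \<Rightarrow>
   ((real^'n) \<times> (real^'p) \<Rightarrow> real) \<Rightarrow> (real^'p \<Rightarrow> real^'p^'p) \<Rightarrow>
   (real^'n) \<times> (real^'p) \<Rightarrow> (real^'n) \<times> (real^'p)" where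
  "closed_loop f h \<Phi> Q = (\<lambda>(x, u). (f (x, u), - (Q u *v HT h u (gradient \<Phi> (x, u)))))"


section \<open>The steady-state optimization problem\<close>

definition feasible_set :: "(real^'p \<Rightarrow> real^'n) \<Rightarrow> ((real^'n) \<times> (real^'p)) set" where
  "feasible_set h = {(x, u). x = h u}"

definition critical_points ::
  "((real^'n) \<times> (real^'p) \<Rightarrow> real) \<Rightarrow> (real^'p \<Rightarrow> real^'n) \<Rightarrow> ((real^'n) \<times> (real^'p)) set" where
  "critical_points \<Phi> h = {(x, u). x = h u \<and>
     (\<exists>\<mu>. gradient \<Phi> (x, u) + (\<mu>, - (transpose (jacobian h (at u)) *v \<mu>)) = 0)}"

definition strict_local_minimizer :: "('a::metric_space \<Rightarrow> real) \<Rightarrow> 'a set \<Rightarrow> 'a \<Rightarrow> bool" where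
  "strict_local_minimizer \<Phi> S ze \<longleftrightarrow> ze \<in> S \<and>
     (\<exists>e>0. \<forall>y\<in>S. y \<noteq> ze \<and> dist y ze < e \<longrightarrow> \<Phi> ze < \<Phi> y)"

end

theory Submission
  imports Defs "HOL-Complex_Analysis.Great_Picard"
begin

text \<open>
  Write \<open>e = \<parallel>x - h u\<parallel>\<close>, \<open>g = H(u)\<^sup>T \<nabla>\<Phi>(x,u)\<^sup>T\<close>, \<open>g\<^sub>0\<close> for the same vector at \<open>(h u, u)\<close> and
  \<open>q = \<parallel>Q(u) g\<parallel>\<close>. The vector \<open>g\<^sub>0\<close> is the gradient of the reduced cost \<open>u \<mapsto> \<Phi>(h u, u)\<close>, and
  \<open>\<parallel>g - g\<^sub>0\<parallel> \<le> L e\<close>. Let \<open>\<kappa>\<close> bound all \<open>\<parallel>Q(u)\<parallel>\<close> with \<open>\<kappa> \<zeta> L < \<gamma>\<close>. Since \<open>q\<^sup>2 \<le> \<kappa> (g \<bullet> Q(u) g)\<close>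
  for positive definite \<open>Q(u)\<close>, the reduced cost changes at a rate at most \<open>- q\<^sup>2/\<kappa> + L e q\<close> along the
  closed loop, and \<open>W\<close> at a rate at most \<open>- \<gamma> e\<^sup>2 + \<zeta> e q\<close>. The combination
  \<open>V(x,u) = \<zeta> \<Phi>(h u, u) + L W(x,u)\<close> balances the two mixed terms, and completing the square gives
  \<open>V' \<le> - D\<close> with \<open>D = (\<zeta>/\<kappa>) (q - \<kappa> L e)\<^sup>2 + L (\<gamma> - \<kappa> \<zeta> L) e\<^sup>2\<close>. This is
  \<open>closed_loop_strict_lyapunov\<close>; the gain condition is exactly what makes the last coefficient
  positive. Thus \<open>D\<close> vanishes only where \<open>e = q = 0\<close>, that is, at critical points, and these are
  equilibria.

  Everything else holds for any continuous vector field with a function \<open>V\<close> that has bounded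
  sublevel sets and decays at a rate \<open>D \<ge> 0\<close> vanishing only at equilibria (locale
  \<open>strict_lyapunov\<close>). Trajectories stay in a compact sublevel set, hence are complete; a limit point
  with \<open>D > 0\<close> would cost a fixed amount of \<open>V\<close> infinitely often, hence they converge to \<open>D = 0\<close>.
  If \<open>ze\<close> is asymptotically stable, a trajectory from a nearby \<open>y\<close> descends to \<open>V ze\<close>, so
  \<open>V ze \<le> V y\<close>, and equality would make \<open>y\<close> an equilibrium that is not attracted. A strict minimum
  of \<open>V\<close> is stable by the classical argument on spheres. Finally \<open>V\<close> equals \<open>\<zeta> \<Phi>\<close> on the feasible set and
  exceeds the reduced cost term off it, which translates strict minima of \<open>V\<close> and of the constrained
  problem into each other.

  The Jacobian of \<open>h\<close> is only continuous, so the closed loop is a merely continuous vector field: its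
  solutions need not be unique, and their existence and continuation rest on Peano's theorem
  (\<open>peano_bounded\<close>, \<open>bounded_trajectory_complete\<close>) together with Zorn's lemma
  (\<open>trajectory_exists\<close>).
\<close>

section \<open>Peano existence\<close>

lemma integral_upto_lipschitz:
  fixes g :: "real \<Rightarrow> 'a::euclidean_space"
  assumes cont: "continuous_on UNIV g" and bound: "\<And>s. norm (g s) \<le> M"
  shows "norm (integral {0..b} g - integral {0..a} g) \<le> M * \<bar>b - a\<bar>"
proof -
  have M: "0 \<le> M" using bound[of 0] norm_ge_zero[of "g 0"] by linarith
  have ig: "g integrable_on {s..t}" for s t
    using cont by (meson continuous_on_subset integrable_continuous_real subset_UNIV)
  have main: "norm (integral {0..b} g - integral {0..a} g) \<le> M * (b - a)" if "a \<le> b" for a b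
  proof (cases "a \<ge> 0")
    case True
    have "integral {0..a} g + integral {a..b} g = integral {0..b} g"
      using True that ig by (intro Henstock_Kurzweil_Integration.integral_combine) auto
    then have "integral {0..b} g - integral {0..a} g = integral {a..b} g"
      by (metis add_diff_cancel_left')
    also have "norm (integral {a..b} g) \<le> M * (b - a)"
      using cont bound that by (intro integral_bound) (auto intro: continuous_on_subset)
    finally show ?thesis .
  next
    case False
    then have a: "integral {0..a} g = 0" by simp
    show ?thesis
    proof (cases "b \<ge> 0")
      case True
      have "norm (integral {0..b} g) \<le> M * (b - 0)"
        using cont bound True by (intro integral_bound) (auto intro: continuous_on_subset)
      also have "\<dots> \<le> M * (b - a)" using M False by (intro mult_left_mono) auto
      finally show ?thesis using a by simp
    next
      case False
      then show ?thesis using a M that by simp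
    qed
  qed
  show ?thesis
  proof (cases "a \<le> b")
    case True then show ?thesis using main[of a b] by simp
  next
    case False then show ?thesis using main[of b a] by (simp add: norm_minus_commute)
  qed
qed

text \<open>Tonelli's approximations: Picard iterates with a delay \<open>d\<close> inside the integral. The delay makes the
  iterates stationary after finitely many steps on any bounded time interval, so they solve the
  delayed equation there although \<open>F\<close> is not Lipschitz.\<close>

primrec delayed_iterate :: "('a::euclidean_space \<Rightarrow> 'a) \<Rightarrow> 'a \<Rightarrow> real \<Rightarrow> nat \<Rightarrow> real \<Rightarrow> 'a" where
  "delayed_iterate F x0 d 0 = (\<lambda>t. x0)"
| "delayed_iterate F x0 d (Suc k) =
     (\<lambda>t. x0 + integral {0..t - d} (\<lambda>s. F (delayed_iterate F x0 d k s)))"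

lemma delayed_iterate_lipschitz:
  fixes F :: "'a::euclidean_space \<Rightarrow> 'a"
  assumes cont: "continuous_on UNIV F" and bound: "\<And>y. norm (F y) \<le> M"
  shows "continuous_on UNIV (delayed_iterate F x0 d k) \<and>
    norm (delayed_iterate F x0 d k t - delayed_iterate F x0 d k s) \<le> M * \<bar>t - s\<bar>"
proof (induction k arbitrary: s t)
  case 0
  have "0 \<le> M" using bound[of 0] norm_ge_zero[of "F 0"] by linarith
  then show ?case by simp
next
  case (Suc k)
  let ?g = "\<lambda>s. F (delayed_iterate F x0 d k s)"
  have M: "0 \<le> M" using bound[of 0] norm_ge_zero[of "F 0"] by linarith
  have c: "continuous_on UNIV ?g"
    using Suc cont by (auto intro!: continuous_on_compose2[OF cont])
  have lip: "norm (delayed_iterate F x0 d (Suc k) t - delayed_iterate F x0 d (Suc k) s)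
      \<le> M * \<bar>t - s\<bar>" for s t
    using integral_upto_lipschitz[OF c bound, of "t - d" "s - d"] by simp
  then have "M-lipschitz_on UNIV (delayed_iterate F x0 d (Suc k))"
    using M by (intro lipschitz_onI) (simp_all add: dist_norm)
  with lip show ?case by (blast intro: lipschitz_on_continuous_on)
qed

text \<open>Values on \<open>[0, (k+1) d]\<close> depend on the previous iterate on \<open>[0, k d]\<close> only.\<close>

lemma delayed_iterate_stable:
  assumes "d > 0" "t \<le> real k * d"
  shows "delayed_iterate F x0 d (Suc k) t = delayed_iterate F x0 d k t"
  using assms(2)
proof (induction k arbitrary: t)
  case 0
  then show ?case using assms(1) by simp
next
  case (Suc k)
  have "integral {0..t - d} (\<lambda>s. F (delayed_iterate F x0 d (Suc k) s)) =
        integral {0..t - d} (\<lambda>s. F (delayed_iterate F x0 d k s))"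
    by (rule Henstock_Kurzweil_Integration.integral_cong)
      (use Suc in \<open>auto simp: algebra_simps simp del: delayed_iterate.simps\<close>)
  then show ?case by simp
qed

text \<open>The solutions of the equations with delay \<open>1/(n+1)\<close> share the Lipschitz constant \<open>M\<close>, so by
  Arzela--Ascoli a subsequence converges uniformly; in the limit the delay, which costs at most
  \<open>M/(n+1)\<close>, disappears from the integral equation.\<close>

lemma peano_bounded:
  fixes F :: "'a::euclidean_space \<Rightarrow> 'a"
  assumes cont: "continuous_on UNIV F" and bound: "\<And>y. norm (F y) \<le> M"
  shows "\<exists>z. z 0 = x0 \<and> ode_solution F z {0..1}"
proof -
  define d where "d n = inverse (real (Suc n))" for n
  define y where "y n = delayed_iterate F x0 (d n) (Suc n)" for n
  have d: "d n > 0" for n by (simp add: d_def)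
  have M: "0 \<le> M" using bound[of 0] norm_ge_zero[of "F 0"] by linarith
  have ycont: "continuous_on UNIV (y n)" for n
    unfolding y_def using delayed_iterate_lipschitz[OF cont bound] by blast
  have ylip: "norm (y n t - y n s) \<le> M * \<bar>t - s\<bar>" for n t s
    unfolding y_def using delayed_iterate_lipschitz[OF cont bound] by blast
  have Fycont: "continuous_on UNIV (\<lambda>s. F (y n s))" for n
    using ycont by (auto intro!: continuous_on_compose2[OF cont])
  have yeq: "y n t = x0 + integral {0..t - d n} (\<lambda>s. F (y n s))" if "t \<le> 1" for n t
  proof -
    have "t \<le> real (Suc n) * d n" using that by (simp add: d_def)
    from delayed_iterate_stable[OF d this, of F x0] show ?thesis
      unfolding y_def by (simp add: d_def)
  qed
  have y0: "y n 0 = x0" for n using yeq[of 0 n] d[of n] by simp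
  have ybd: "norm (y n t - x0) \<le> M" if "t \<in> {0..1}" for n t
  proof -
    have "norm (y n t - x0) \<le> M * \<bar>t\<bar>" using ylip[of n t 0] y0 by simp
    also have "\<dots> \<le> M * 1" using that M by (intro mult_left_mono) auto
    finally show ?thesis by simp
  qed
  obtain g k where g: "continuous_on {0..1} g" and k: "strict_mono (k::nat\<Rightarrow>nat)"
    and lim: "\<And>e. 0 < e \<Longrightarrow> \<exists>N. \<forall>n x. n \<ge> N \<and> x \<in> {0..1} \<longrightarrow> norm (y (k n) x - g x) < e"
  proof (rule Arzela_Ascoli[of "{0..1::real}" y "norm x0 + M"])
    show "norm (y n x) \<le> norm x0 + M" if "x \<in> {0..1}" for n x
      using ybd[OF that, of n] norm_triangle_ineq2[of "y n x" x0] by linarith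
    show "\<exists>d>0. \<forall>n z. z \<in> {0..1} \<and> norm (x - z) < d \<longrightarrow> norm (y n x - y n z) < e"
      if "0 < e" for x e
    proof (intro exI conjI allI impI)
      show "0 < e / (M + 1)" using that M by simp
      fix n z assume "z \<in> {0..1} \<and> norm (x - z) < e / (M + 1)"
      then have "\<bar>x - z\<bar> * (M + 1) < e" using M by (simp add: field_simps)
      moreover have "norm (y n x - y n z) \<le> M * \<bar>x - z\<bar>" by (rule ylip)
      ultimately show "norm (y n x - y n z) < e" by (simp add: algebra_simps)
    qed
  qed auto
  have ul: "uniform_limit {0..1} (\<lambda>n. y (k n)) g sequentially"
    unfolding uniform_limit_sequentially_iff dist_norm using lim by blast
  have gy: "(\<lambda>n. y (k n) t) \<longlonglongrightarrow> g t" if "t \<in> {0..1}" for t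
    using ul that by (rule tendsto_uniform_limitI)
  have ulF: "uniform_limit {0..1} (\<lambda>n s. F (y (k n) s)) (\<lambda>s. F (g s)) sequentially"
  proof (rule uniform_limit_compose_uniformly_continuous_on[where B="cball x0 M", OF ul])
    show "uniformly_continuous_on (cball x0 M) F"
      by (intro compact_uniformly_continuous continuous_on_subset[OF cont]) auto
  qed (use ybd in \<open>auto simp: dist_norm norm_minus_commute\<close>)
  have eq: "g t = x0 + integral {0..t} (\<lambda>s. F (g s))" if t: "t \<in> {0..1}" for t
  proof -
    have "uniform_limit {0..t} (\<lambda>n s. F (y (k n) s)) (\<lambda>s. F (g s)) sequentially"
      using t by (intro uniform_limit_on_subset[OF ulF]) auto
    then obtain I J where I: "\<And>n. ((\<lambda>s. F (y (k n) s)) has_integral I n) {0..t}"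
      and J: "((\<lambda>s. F (g s)) has_integral J) {0..t}" and IJ: "I \<longlonglongrightarrow> J"
      by (rule uniform_limit_integral) (use Fycont in \<open>auto intro: continuous_on_subset\<close>)
    have err: "norm (y (k n) t - (x0 + I n)) \<le> M * d (k n)" for n
    proof -
      have "y (k n) t - (x0 + I n) = integral {0..t - d (k n)} (\<lambda>s. F (y (k n) s))
            - integral {0..t} (\<lambda>s. F (y (k n) s))"
        using yeq[of t "k n"] t integral_unique[OF I[of n]] by simp
      then show ?thesis
        using integral_upto_lipschitz[OF Fycont bound, of "t - d (k n)" "k n" t] d[of "k n"] by simp
    qed
    have "(\<lambda>n. d (k n)) \<longlonglongrightarrow> 0"
      using LIMSEQ_subseq_LIMSEQ[OF LIMSEQ_inverse_real_of_nat k] unfolding d_def o_def .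
    then have small: "(\<lambda>n. M * d (k n)) \<longlonglongrightarrow> 0" by (rule tendsto_mult_right_zero)
    have "(\<lambda>n. y (k n) t - (x0 + I n)) \<longlonglongrightarrow> 0"
      by (rule Lim_null_comparison[OF always_eventually small]) (use err in blast)
    from tendsto_add[OF this tendsto_add[OF tendsto_const[of x0] IJ]]
    have "(\<lambda>n. y (k n) t) \<longlonglongrightarrow> x0 + J" by simp
    then have "g t = x0 + J" using gy[OF t] LIMSEQ_unique by blast
    then show ?thesis using integral_unique[OF J] by simp
  qed
  have Fg: "continuous_on {0..1} (\<lambda>s. F (g s))"
    using g by (auto intro!: continuous_on_compose2[OF cont])
  have "(g has_vector_derivative F (g t)) (at t within {0..1})" if t: "t \<in> {0..1}" for t
  proof (rule has_vector_derivative_transform[OF t eq])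
    show "((\<lambda>t. x0 + integral {0..t} (\<lambda>s. F (g s))) has_vector_derivative F (g t))
        (at t within {0..1})"
      using integral_has_vector_derivative[OF Fg t] by (auto intro!: derivative_eq_intros)
  qed
  then show ?thesis
    using eq[of 0] by (intro exI[of _ g]) (auto simp: ode_solution_def is_interval_cc)
qed

section \<open>Continuation of solutions\<close>

lemma ode_solution_subset:
  assumes "ode_solution F z J" "is_interval J'" "0 \<in> J'" "J' \<subseteq> J"
  shows "ode_solution F z J'"
  using assms unfolding ode_solution_def
  by (meson has_vector_derivative_within_subset subset_iff subset_trans)

lemma ode_solution_continuous_on: "ode_solution F z J \<Longrightarrow> continuous_on J z"
  unfolding ode_solution_def by (rule continuous_on_vector_derivative) blast

lemma ode_solution_lipschitz:
  assumes "ode_solution F z J" and "\<And>t. t \<in> J \<Longrightarrow> norm (F (z t)) \<le> M"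
    and "s \<in> J" "t \<in> J"
  shows "norm (z t - z s) \<le> M * \<bar>t - s\<bar>"
proof -
  have "norm (z t - z s) \<le> M * norm (t - s)"
  proof (rule differentiable_bound[of J z "\<lambda>t h. h *\<^sub>R F (z t)"])
    show "convex J" using assms(1) by (auto simp: ode_solution_def is_interval_convex_1)
    show "(z has_derivative (\<lambda>h. h *\<^sub>R F (z r))) (at r within J)" if "r \<in> J" for r
      using assms(1) that by (auto simp: ode_solution_def has_vector_derivative_def)
    show "onorm (\<lambda>h. h *\<^sub>R F (z r)) \<le> M" if "r \<in> J" for r
      using assms(2)[OF that] by (intro onorm_le) (simp add: mult.commute[of M] mult_left_mono)
  qed (use assms in auto)
  then show ?thesis by simp
qed

text \<open>Composing \<open>F\<close> with the projection onto a ball makes it bounded without changing it near \<open>x0\<close>.\<close>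

lemma peano_local:
  fixes F :: "'a::euclidean_space \<Rightarrow> 'a"
  assumes cont: "continuous_on UNIV F"
  shows "\<exists>s>0. \<exists>z. z 0 = x0 \<and> ode_solution F z {0..s}"
proof -
  let ?B = "cball x0 1"
  define G where "G = (\<lambda>y. F (closest_point ?B y))"
  have cp: "continuous_on UNIV (closest_point ?B)" "closest_point ?B y \<in> ?B" for y
    by (intro continuous_on_closest_point closest_point_in_set; simp)+
  have G: "continuous_on UNIV G" unfolding G_def
    using cp by (auto intro!: continuous_on_compose2[OF cont])
  have "bounded (F ` ?B)"
    by (intro compact_imp_bounded compact_continuous_image continuous_on_subset[OF cont]) auto
  then obtain M where "\<And>y. y \<in> ?B \<Longrightarrow> norm (F y) \<le> M"
    unfolding bounded_iff by (metis imageI)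
  then have "norm (G y) \<le> M" for y unfolding G_def using cp(2) by blast
  from peano_bounded[OF G this] obtain z where z: "z 0 = x0" "ode_solution G z {0..1}" by blast
  have "continuous_on {0..1} z" using z(2) by (rule ode_solution_continuous_on)
  then obtain d where d: "d > 0" "\<And>t. t \<in> {0..1} \<Longrightarrow> dist t 0 < d \<Longrightarrow> dist (z t) (z 0) < 1"
    unfolding continuous_on_iff by (metis atLeastAtMost_iff order_refl zero_le_one zero_less_one)
  define s where "s = min 1 (d/2)"
  have s: "s > 0" "s \<le> 1" "s < d" using d(1) by (auto simp: s_def)
  have "ode_solution G z {0..s}" using s by (intro ode_solution_subset[OF z(2)]) (auto simp: is_interval_cc)
  moreover have "G (z t) = F (z t)" if "t \<in> {0..s}" for t
  proof -
    have "z t \<in> ?B" using d(2)[of t] that s z(1) by (auto simp: dist_commute)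
    then show ?thesis by (simp add: G_def closest_point_self)
  qed
  ultimately have "ode_solution F z {0..s}" by (auto simp: ode_solution_def)
  then show ?thesis using s z by blast
qed

text \<open>Bounded speed makes \<open>z\<close> uniformly continuous, so it has a limit at \<open>T\<close>. The equation at the endpoint
  itself comes from the integral form, which passes to the closure by continuity.\<close>

lemma ode_solution_extend_to_endpoint:
  fixes F :: "'a::euclidean_space \<Rightarrow> 'a"
  assumes cont: "continuous_on UNIV F" and z: "ode_solution F z {0..<T}"
    and bound: "\<And>t. t \<in> {0..<T} \<Longrightarrow> norm (F (z t)) \<le> M"
  shows "\<exists>y. ode_solution F y {0..T} \<and> (\<forall>t\<in>{0..<T}. y t = z t)"
proof -
  have T: "T > 0" using z by (auto simp: ode_solution_def)
  have M: "0 \<le> M" using bound[of 0] norm_ge_zero[of "F (z 0)"] T by (simp del: norm_ge_zero)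
  have "M-lipschitz_on {0..<T} z"
    using M ode_solution_lipschitz[OF z bound] by (intro lipschitz_onI) (auto simp: dist_norm)
  then have "uniformly_continuous_on {0..<T} z" by (rule lipschitz_on_uniformly_continuous)
  then obtain g where "uniformly_continuous_on (closure {0..<T}) g"
    and gz: "\<And>t. t \<in> {0..<T} \<Longrightarrow> z t = g t"
    by (rule uniformly_continuous_on_extension_on_closure) blast
  then have g: "continuous_on {0..T} g"
    using T by (simp add: uniformly_continuous_imp_continuous)
  have Fg: "continuous_on {0..T} (\<lambda>s. F (g s))"
    using g by (auto intro!: continuous_on_compose2[OF cont])
  have eq0: "g t - (z 0 + integral {0..t} (\<lambda>s. F (g s))) = 0" if t: "t \<in> {0..<T}" for t
  proof -
    have "((\<lambda>s. F (z s)) has_integral z t - z 0) {0..t}"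
    proof (rule fundamental_theorem_of_calculus)
      have "ode_solution F z {0..t}"
        using t by (intro ode_solution_subset[OF z]) (auto simp: is_interval_cc)
      then show "(z has_vector_derivative F (z s)) (at s within {0..t})" if "s \<in> {0..t}" for s
        using that by (simp add: ode_solution_def)
    qed (use t in simp)
    then have "((\<lambda>s. F (g s)) has_integral z t - z 0) {0..t}"
      by (rule has_integral_eq[rotated]) (use gz t in auto)
    then show ?thesis using gz[OF t] by (simp add: integral_unique)
  qed
  have "continuous_on {0..T} (\<lambda>t. integral {0..t} (\<lambda>s. F (g s)))"
    by (intro indefinite_integral_continuous_1 integrable_continuous_real Fg)
  then have "continuous_on (closure {0..<T}) (\<lambda>t. g t - (z 0 + integral {0..t} (\<lambda>s. F (g s))))"
    using T by (auto intro!: continuous_intros g)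
  then have eq: "g t = z 0 + integral {0..t} (\<lambda>s. F (g s))" if "t \<in> {0..T}" for t
    using continuous_constant_on_closure[of "{0..<T}" _ 0 t] eq0 that T by fastforce
  have "(g has_vector_derivative F (g t)) (at t within {0..T})" if t: "t \<in> {0..T}" for t
  proof (rule has_vector_derivative_transform[OF t eq])
    show "((\<lambda>t. z 0 + integral {0..t} (\<lambda>s. F (g s))) has_vector_derivative F (g t))
        (at t within {0..T})"
      using integral_has_vector_derivative[OF Fg t] by (auto intro!: derivative_eq_intros)
  qed
  then show ?thesis using T gz
    by (intro exI[of _ g]) (auto simp: ode_solution_def is_interval_cc)
qed

lemma ode_solution_append:
  assumes z: "ode_solution F z {0..T}" and y: "ode_solution F y {0..s}" and y0: "y 0 = z T"
  shows "ode_solution F (\<lambda>t. if t \<le> T then z t else y (t - T)) {0..T + s}"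
    (is "ode_solution F ?w _")
proof -
  have T: "0 \<le> T" and s: "0 \<le> s" using z y by (auto simp: ode_solution_def)
  have shift: "((\<lambda>t. y (t - T)) has_vector_derivative F (y (t - T))) (at t within {T..T + s})"
    if "t \<in> {T..T + s}" for t
  proof -
    have "(y has_vector_derivative F (y (t - T))) (at (t - T) within {0..s})"
      using y that by (auto simp: ode_solution_def)
    moreover have "(\<lambda>t. t - T) ` {T..T + s} = {0..s}"
      using image_add_atLeastAtMost'[of "- T" T "T + s"] by simp
    moreover have "((\<lambda>t. t - T) has_vector_derivative 1) (at t within {T..T + s})"
      by (auto intro!: derivative_eq_intros)
    ultimately show ?thesis
      using vector_diff_chain_within[of "\<lambda>t. t - T" 1 t "{T..T+s}" y "F (y (t - T))"]
      by (simp add: o_def)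
  qed
  have "(?w has_vector_derivative F (?w t)) (at t within {0..T + s})" if t: "t \<in> {0..T + s}" for t
  proof -
    have "((\<lambda>t. if t \<in> {0..T} then z t else y (t - T)) has_vector_derivative
        (if t \<in> {0..T} then F (z t) else F (y (t - T)))) (at t within {0..T + s})"
    proof (rule has_vector_derivative_If_within_closures[of t "{0..T}" "{T..T + s}"])
      have c: "closure {0..T} \<inter> closure {T..T + s} = {T}" using T s by auto
      show "(z has_vector_derivative F (z t)) (at t within {0..T} \<union> (closure {0..T} \<inter> closure {T..T + s}))"
        if "t \<in> {0..T} \<union> (closure {0..T} \<inter> closure {T..T + s})"
      proof -
        have "{0..T} \<union> {T} = {0..T}" using T by auto
        then show ?thesis using that z unfolding c by (auto simp: ode_solution_def)
      qed
      show "((\<lambda>t. y (t - T)) has_vector_derivative F (y (t - T)))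
          (at t within {T..T + s} \<union> (closure {0..T} \<inter> closure {T..T + s}))"
        if "t \<in> {T..T + s} \<union> (closure {0..T} \<inter> closure {T..T + s})"
      proof -
        have "{T..T + s} \<union> {T} = {T..T + s}" using s by auto
        then show ?thesis using that shift unfolding c by auto
      qed
      show "t \<in> {0..T} \<union> {T..T + s}" using t by auto
      show "{0..T + s} = {0..T} \<union> {T..T + s}" using T s by auto
      show "z t = y (t - T)" "F (z t) = F (y (t - T))"
        if "t \<in> closure {0..T}" "t \<in> closure {T..T + s}"
      proof -
        have "t = T" using that by simp
        then show "z t = y (t - T)" "F (z t) = F (y (t - T))" using y0 by simp_all
      qed
    qed
    moreover have speed: "(if t \<in> {0..T} then F (z t) else F (y (t - T))) = F (?w t)"
      using t by simp
    ultimately have "((\<lambda>t. if t \<in> {0..T} then z t else y (t - T)) has_vector_derivative F (?w t))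
        (at t within {0..T + s})" unfolding speed by blast
    then show ?thesis
      by (rule has_vector_derivative_transform[OF t, rotated]) simp
  qed
  then show ?thesis using T s by (auto simp: ode_solution_def is_interval_cc)
qed

text \<open>If the domain of a maximal solution had a finite supremum \<open>T\<close>, the solution could be continued: to
  \<open>T\<close> if \<open>T\<close> is not in the domain, and beyond \<open>T\<close> by Peano's theorem otherwise.\<close>

lemma bounded_trajectory_complete:
  fixes F :: "'a::euclidean_space \<Rightarrow> 'a"
  assumes cont: "continuous_on UNIV F" and traj: "trajectory F z J" and bd: "bounded (z ` J)"
  shows "J = {0..}"
proof -
  have sol: "ode_solution F z J" using traj by (simp add: trajectory_def)
  have J: "0 \<in> J" "J \<subseteq> {0..}" "is_interval J" using sol by (auto simp: ode_solution_def)
  have below: "t \<in> J" if "0 \<le> t" "t \<le> r" "r \<in> J" for t r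
    using J that by (meson is_interval_1)
  have max: "J' = J" if "ode_solution F y J'" "J \<subseteq> J'" "\<forall>t\<in>J. y t = z t" for y J'
    using traj that by (auto simp: trajectory_def)
  have "compact (closure (z ` J))" using bd by simp
  then have "bounded (F ` closure (z ` J))"
    by (intro compact_imp_bounded compact_continuous_image continuous_on_subset[OF cont]) auto
  then obtain M where "\<And>y. y \<in> closure (z ` J) \<Longrightarrow> norm (F y) \<le> M"
    unfolding bounded_iff by (metis imageI)
  then have M: "norm (F (z t)) \<le> M" if "t \<in> J" for t
    using that by (meson closure_subset image_eqI subsetD)
  have "\<not> bdd_above J"
  proof
    assume bdd: "bdd_above J"
    define T where "T = Sup J"
    have le: "t \<le> T" if "t \<in> J" for t unfolding T_def using bdd that by (rule cSup_upper[rotated])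
    have lt: "t \<in> J" if "0 \<le> t" "t < T" for t
    proof -
      obtain r where "r \<in> J" "t < r"
        using \<open>t < T\<close> J(1) bdd unfolding T_def by (metis empty_iff less_cSup_iff)
      then show ?thesis using below \<open>0 \<le> t\<close> by (meson less_imp_le)
    qed
    show False
    proof (cases "T \<in> J")
      case True
      have JT: "J = {0..T}"
      proof
        show "J \<subseteq> {0..T}" using le J(2) by fastforce
        show "{0..T} \<subseteq> J" using below[OF _ _ True] by auto
      qed
      obtain s y where s: "s > 0" "y 0 = z T" "ode_solution F y {0..s}"
        using peano_local[OF cont] by blast
      then have "ode_solution F (\<lambda>t. if t \<le> T then z t else y (t - T)) {0..T + s}"
        using sol JT by (intro ode_solution_append) auto
      then have "{0..T + s} = J" by (rule max) (use JT s in auto)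
      then show False using JT s le[OF J(1)] by auto
    next
      case False
      have JT: "J = {0..<T}"
      proof
        show "J \<subseteq> {0..<T}" using le J(2) False by (metis atLeastLessThan_iff atLeast_iff order_less_le subsetI subsetD)
        show "{0..<T} \<subseteq> J" using lt by auto
      qed
      obtain y where y: "ode_solution F y {0..T}" "\<forall>t\<in>{0..<T}. y t = z t"
        using ode_solution_extend_to_endpoint[OF cont] sol M JT by metis
      then have "{0..T} = J" by (intro max) (use JT in auto)
      then show False using False le[OF J(1)] by auto
    qed
  qed
  then have "t \<in> J" if "0 \<le> t" for t
    using below[OF that] unfolding bdd_above_def by (meson linear)
  then show ?thesis using J(2) by auto
qed

text \<open>Zorn's lemma applied to the graphs of solutions, ordered by inclusion. The empty chain is bounded
  by the solution with the one-point domain \<open>{0}\<close>.\<close>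

lemma trajectory_exists:
  fixes F :: "'a::real_normed_vector \<Rightarrow> 'a"
  shows "\<exists>z J. trajectory F z J \<and> z 0 = x0"
proof -
  define graph where "graph = (\<lambda>(z :: real \<Rightarrow> 'a) J. (\<lambda>t. (t, z t)) ` J)"
  have graph_iff: "(t, v) \<in> graph z J \<longleftrightarrow> t \<in> J \<and> v = z t" for t v z J
    by (auto simp: graph_def)
  define A where "A = {graph z J | z J. ode_solution F z J \<and> z 0 = x0}"
  have "\<exists>U\<in>A. \<forall>X\<in>C. X \<subseteq> U" if C: "C \<in> chains A" for C
  proof (cases "C = {}")
    case True
    have "ode_solution F (\<lambda>t. x0) {0}"
    proof -
      have "at (0::real) within {0} = bot" by (simp add: at_within_eq_bot_iff)
      then show ?thesis
        by (auto simp: ode_solution_def has_vector_derivative_def has_derivative_def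
            bounded_linear_scaleR_left is_interval_1)
    qed
    then show ?thesis using True by (auto simp: A_def)
  next
    case False
    have CA: "\<exists>w J. X = graph w J \<and> ode_solution F w J \<and> w 0 = x0" if "X \<in> C" for X
      using C that by (auto simp: chains_def A_def)
    define G where "G = \<Union>C"
    have single: "v = v'" if tv: "(t, v) \<in> G" "(t, v') \<in> G" for t v v'
    proof -
      obtain X Y where "X \<in> C" "Y \<in> C" "(t, v) \<in> X" "(t, v') \<in> Y" using tv unfolding G_def by blast
      then obtain Z where "Z \<in> C" "(t, v) \<in> Z" "(t, v') \<in> Z" using chainsD[OF C] by blast
      moreover obtain w J where "Z = graph w J" using CA \<open>Z \<in> C\<close> by blast
      ultimately show ?thesis by (simp add: graph_iff)
    qed
    define z where "z t = (THE v. (t, v) \<in> G)" for t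
    have z: "z t = v" if "(t, v) \<in> G" for t v
      unfolding z_def using that single by (blast intro: the_equality)
    define I where "I = fst ` G"
    have cover: "\<exists>w J. graph w J \<in> C \<and> ode_solution F w J \<and> w 0 = x0 \<and> t \<in> J" if "t \<in> I" for t
    proof -
      obtain v X where "X \<in> C" "(t, v) \<in> X" using \<open>t \<in> I\<close> by (auto simp: I_def G_def)
      moreover obtain w J where "X = graph w J" "ode_solution F w J" "w 0 = x0"
        using CA \<open>X \<in> C\<close> by blast
      ultimately show ?thesis by (auto simp: graph_iff)
    qed
    have sub: "J \<subseteq> I" "\<And>t. t \<in> J \<Longrightarrow> z t = w t" if "graph w J \<in> C" for w J
    proof -
      have "(t, w t) \<in> G" if "t \<in> J" for t
        using \<open>graph w J \<in> C\<close> that graph_iff unfolding G_def by blast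
      then show "J \<subseteq> I" "\<And>t. t \<in> J \<Longrightarrow> z t = w t"
        using z by (force simp: I_def)+
    qed
    have nonneg: "0 \<le> t" if "t \<in> I" for t
      using cover[OF that] by (auto simp: ode_solution_def)
    have below: "r \<in> J" if "ode_solution F w J" "t \<in> J" "0 \<le> r" "r \<le> t" for w J r t
      using that unfolding ode_solution_def is_interval_1 by blast
    have start: "0 \<in> I \<and> z 0 = x0"
    proof -
      obtain w J where "graph w J \<in> C" "ode_solution F w J" "w 0 = x0"
        using False CA by blast
      then show ?thesis using sub[of w J] by (auto simp: ode_solution_def)
    qed
    have interval: "is_interval I"
      unfolding is_interval_1
    proof (intro ballI allI impI)
      fix a b r assume "a \<in> I" "b \<in> I" "a \<le> r \<and> r \<le> b"
      moreover obtain w J where "graph w J \<in> C" "ode_solution F w J" "b \<in> J"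
        using cover[OF \<open>b \<in> I\<close>] by blast
      ultimately show "r \<in> I" using below[of w J b r] nonneg[of a] sub(1) by auto
    qed
    have "(z has_vector_derivative F (z t)) (at t within I)" if t: "t \<in> I" for t
    proof -
      \<comment> \<open>Near \<open>t\<close> a single member of the chain describes all of \<open>z\<close>: one whose domain reaches beyond \<open>t\<close>,
        or any one containing \<open>t\<close> if \<open>t\<close> is the last time of the union.\<close>
      have "\<exists>w J d. graph w J \<in> C \<and> ode_solution F w J \<and> t \<in> J \<and> d > 0 \<and> I \<inter> ball t d \<subseteq> J"
      proof (cases "\<exists>t'\<in>I. t < t'")
        case True
        then obtain t' where t': "t' \<in> I" "t < t'" by blast
        obtain w J where J: "graph w J \<in> C" "ode_solution F w J" "t' \<in> J"
          using cover[OF t'(1)] by blast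
        have "t \<in> J" using below[OF J(2,3)] nonneg[OF t] t' by auto
        moreover have "I \<inter> ball t (t' - t) \<subseteq> J"
          using below[OF J(2,3)] nonneg t' by (auto simp: dist_real_def)
        ultimately show ?thesis using J t' by (meson diff_gt_0_iff_gt)
      next
        case False
        obtain w J where J: "graph w J \<in> C" "ode_solution F w J" "t \<in> J"
          using cover[OF t] by blast
        have "I \<inter> ball t 1 \<subseteq> J" using below[OF J(2,3)] nonneg False by force
        then show ?thesis using J by (meson zero_less_one)
      qed
      then obtain w J d where J: "graph w J \<in> C" "ode_solution F w J" "t \<in> J"
        and d: "d > 0" "I \<inter> ball t d \<subseteq> J" by blast
      have "at t within I = at t within J"
        using sub(1)[OF J(1)] d by (intro at_within_nhd[of t "ball t d"]) auto
      then have "(w has_vector_derivative F (z t)) (at t within I)"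
        using J sub(2)[OF J(1) J(3)] by (simp add: ode_solution_def)
      then show ?thesis
        by (rule has_vector_derivative_transform_within[OF _ d(1) t])
          (use d(2) sub(2)[OF J(1)] in \<open>auto simp: dist_commute subset_iff\<close>)
    qed
    then have "ode_solution F z I"
      using start interval nonneg by (auto simp: ode_solution_def)
    then have "graph z I \<in> A" using start by (auto simp: A_def)
    moreover have "X \<subseteq> graph z I" if X: "X \<in> C" for X
    proof
      fix p assume "p \<in> X"
      then have "p \<in> G" using X by (auto simp: G_def)
      then show "p \<in> graph z I" using z[of "fst p" "snd p"]
        by (auto simp: I_def graph_def image_iff prod_eq_iff)
    qed
    ultimately show ?thesis by blast
  qed
  from Zorn_Lemma2[OF ballI[OF this]]
  obtain G where G: "G \<in> A" and max: "\<And>X. X \<in> A \<Longrightarrow> G \<subseteq> X \<Longrightarrow> X = G" by blast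
  from G obtain z J where z: "G = graph z J" "ode_solution F z J" "z 0 = x0"
    by (auto simp: A_def)
  have "J' = J" if y: "ode_solution F y J'" "J \<subseteq> J'" "\<forall>t\<in>J. y t = z t" for y J'
  proof -
    have "0 \<in> J" using z(2) by (simp add: ode_solution_def)
    then have "graph y J' \<in> A" using y z(3) by (auto simp: A_def)
    moreover have "G \<subseteq> graph y J'" using y z(1) by (auto simp: graph_def image_iff)
    ultimately have "graph y J' = graph z J" using max z(1) by blast
    then show ?thesis using graph_iff by blast
  qed
  then have "trajectory F z J" using z(2) unfolding trajectory_def by blast
  then show ?thesis using z(3) by blast
qed

section \<open>Strict Lyapunov functions for continuous vector fields\<close>

lemma ode_solution_interval:
  assumes "ode_solution F z J" "a \<in> J" "b \<in> J"
  shows "{a..b} \<subseteq> J"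
  using assms unfolding ode_solution_def is_interval_1 by (meson atLeastAtMost_iff subsetI)

locale strict_lyapunov =
  fixes F :: "'a::euclidean_space \<Rightarrow> 'a" and V :: "'a \<Rightarrow> real" and V' :: "'a \<Rightarrow> 'a \<Rightarrow> real"
    and D :: "'a \<Rightarrow> real"
  assumes cont_F: "continuous_on UNIV F" and cont_D: "continuous_on UNIV D"
    and V': "\<And>z. (V has_derivative V' z) (at z)"
    and D_nonneg: "\<And>z. 0 \<le> D z"
    and decay: "\<And>z. V' z (F z) \<le> - D z"
    and D_zero: "\<And>z. D z = 0 \<Longrightarrow> F z = 0"
    and bounded_sublevel: "\<And>c. bounded {z. V z \<le> c}"
begin

lemma cont_V: "continuous_on S V"
  by (rule continuous_on_subset[of UNIV], rule has_derivative_continuous_on) (use V' in auto)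

lemma compact_sublevel: "compact {z. V z \<le> c}"
  unfolding compact_eq_bounded_closed
  by (intro conjI bounded_sublevel closed_Collect_le cont_V continuous_on_const)

lemma V_bounded_below: "\<exists>m. \<forall>z. m \<le> V z"
proof -
  obtain x where x: "x \<in> {z. V z \<le> V 0}" "\<forall>y\<in>{z. V z \<le> V 0}. V x \<le> V y"
    using continuous_attains_inf[OF compact_sublevel[of "V 0"] _ cont_V] by blast
  then have "V x \<le> V y" for y by (cases "V y \<le> V 0") auto
  then show ?thesis by blast
qed

text \<open>By the mean value theorem rather than by integrating \<open>V'\<close>, which may be discontinuous: a plant Lyapunov
  function is differentiable but possibly not \<open>C1\<close>.\<close>

lemma V_decreases:
  assumes sol: "ode_solution F z J" and ab: "a \<in> J" "b \<in> J" "a \<le> b"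
    and rate: "\<And>t. a \<le> t \<Longrightarrow> t \<le> b \<Longrightarrow> m \<le> D (z t)"
  shows "V (z b) \<le> V (z a) - m * (b - a)"
proof -
  have sub: "{a..b} \<subseteq> J" by (rule ode_solution_interval[OF sol ab(1,2)])
  have "((\<lambda>t. V (z t)) has_derivative (\<lambda>h. V' (z t) (h *\<^sub>R F (z t)))) (at t within {a..b})"
    if "a \<le> t" "t \<le> b" for t
  proof -
    have "(z has_vector_derivative F (z t)) (at t within {a..b})"
      using sol sub that unfolding ode_solution_def
      by (meson atLeastAtMost_iff has_vector_derivative_within_subset subsetD)
    then show ?thesis
      unfolding has_vector_derivative_def
      by (rule has_derivative_compose) (rule V')
  qed
  from mvt_very_simple[OF ab(3) this]
  obtain t where t: "a \<le> t" "t \<le> b" "V (z b) - V (z a) = V' (z t) ((b - a) *\<^sub>R F (z t))"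
    by auto
  have "V' (z t) ((b - a) *\<^sub>R F (z t)) = (b - a) * V' (z t) (F (z t))"
    using linear_scale[OF has_derivative_linear[OF V'], of "z t" "b - a"] by simp
  also have "\<dots> \<le> (b - a) * (- m)"
    using decay[of "z t"] rate[OF t(1,2)] ab(3) by (intro mult_left_mono) auto
  finally show ?thesis using t(3) by (simp add: algebra_simps)
qed

lemma V_nonincreasing:
  assumes "ode_solution F z J" "a \<in> J" "b \<in> J" "a \<le> b"
  shows "V (z b) \<le> V (z a)"
  using V_decreases[OF assms, of 0] D_nonneg by simp

lemma trajectory_in_sublevel:
  assumes "ode_solution F z J" "t \<in> J"
  shows "V (z t) \<le> V (z 0)"
  using V_nonincreasing[OF assms(1) _ assms(2)] assms by (auto simp: ode_solution_def)

lemma trajectory_complete: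
  assumes "trajectory F z J"
  shows "J = {0..}"
proof (rule bounded_trajectory_complete[OF cont_F assms])
  have "z ` J \<subseteq> {y. V y \<le> V (z 0)}"
    using assms trajectory_in_sublevel by (auto simp: trajectory_def)
  then show "bounded (z ` J)" using bounded_sublevel bounded_subset by blast
qed

text \<open>A limit point \<open>q\<close> with \<open>D q > 0\<close> is impossible: \<open>D\<close> exceeds \<open>D q / 2\<close> on a ball around \<open>q\<close>, and since the speed is
  bounded, every late visit to the half-size ball lasts at least a fixed time \<open>\<delta>\<close>. It therefore costs
  \<open>D q / 2 * \<delta>\<close> of \<open>V\<close>, more than what is eventually left above the infimum of \<open>V\<close> along the trajectory.\<close>

lemma trajectory_converges:
  assumes "trajectory F z J"
  shows "converges_to_set z {p. D p = 0}"
  unfolding converges_to_set_def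
proof (intro allI impI, rule ccontr)
  fix e :: real
  assume e: "e > 0" and "\<not> (\<forall>\<^sub>F t in at_top. \<exists>c\<in>{p. D p = 0}. dist (z t) c < e)"
  then have "\<exists>t\<ge>N. \<forall>c\<in>{p. D p = 0}. e \<le> dist (z t) c" for N
    unfolding eventually_at_top_linorder by (meson linorder_not_less)
  then have "\<forall>n::nat. \<exists>t\<ge>real n. \<forall>c. D c = 0 \<longrightarrow> e \<le> dist (z t) c" by auto
  then obtain \<tau> where \<tau>: "\<And>n. real n \<le> \<tau> n" "\<And>n c. D c = 0 \<Longrightarrow> e \<le> dist (z (\<tau> n)) c"
    by metis
  have sol: "ode_solution F z {0..}"
    using assms trajectory_complete by (auto simp: trajectory_def)
  define K where "K = {y. V y \<le> V (z 0)}"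
  have K: "compact K" "\<And>t. t \<ge> 0 \<Longrightarrow> z t \<in> K"
    unfolding K_def using compact_sublevel trajectory_in_sublevel[OF sol] by auto
  have \<tau>0: "0 \<le> \<tau> n" for n using \<tau>(1)[of n] of_nat_0_le_iff order_trans by blast
  obtain q r where q: "q \<in> K" and r: "strict_mono (r :: nat \<Rightarrow> nat)"
    and lim: "((\<lambda>n. z (\<tau> n)) \<circ> r) \<longlonglongrightarrow> q"
    using K \<tau>0 unfolding compact_def by meson
  have "D q \<noteq> 0"
  proof
    assume "D q = 0"
    then have "e \<le> dist (z (\<tau> (r n))) q" for n using \<tau>(2) by blast
    moreover have "\<forall>\<^sub>F n in sequentially. dist (z (\<tau> (r n))) q < e"
      using tendstoD[OF lim e] by simp
    ultimately show False by (auto simp: eventually_sequentially not_le[symmetric])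
  qed
  then have Dq: "D q > 0" using D_nonneg[of q] by simp
  have "isCont D q" using cont_D by (simp add: continuous_on_eq_continuous_at)
  then have "\<forall>\<^sub>F y in nhds q. D q / 2 < D y"
    using Dq by (intro order_tendstoD(1)) (auto simp: isCont_def tendsto_at_iff_tendsto_nhds)
  then obtain \<rho> where \<rho>: "\<rho> > 0" "\<And>y. dist y q < \<rho> \<Longrightarrow> D q / 2 < D y"
    unfolding eventually_nhds_metric by blast
  have "bounded (F ` K)"
    by (intro compact_imp_bounded compact_continuous_image continuous_on_subset[OF cont_F] K) auto
  then obtain M where M: "M > 0" "\<And>y. y \<in> K \<Longrightarrow> norm (F y) \<le> M"
    unfolding bounded_pos by auto
  define \<delta> where "\<delta> = \<rho> / (2 * M)"
  have \<delta>: "\<delta> > 0" "M * \<delta> = \<rho> / 2" using \<rho> M by (auto simp: \<delta>_def)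
  define v where "v = Inf ((\<lambda>t. V (z t)) ` {0..})"
  have bdd: "bdd_below ((\<lambda>t. V (z t)) ` {0..})"
    using V_bounded_below by (auto simp: bdd_below_def)
  have v: "v \<le> V (z t)" if "t \<ge> 0" for t
    unfolding v_def using bdd that by (auto intro: cInf_lower)
  have "\<exists>x\<in>(\<lambda>t. V (z t)) ` {0..}. x < v + D q / 2 * \<delta>"
    using Dq \<delta> by (intro cInf_lessD) (auto simp: v_def)
  then obtain T where T: "T \<ge> 0" "V (z T) < v + D q / 2 * \<delta>" by auto
  obtain N0 where N0: "\<And>n. n \<ge> N0 \<Longrightarrow> dist (z (\<tau> (r n))) q < \<rho> / 2"
    using tendstoD[OF lim, of "\<rho> / 2"] \<rho> by (auto simp: eventually_sequentially)
  define n where "n = max N0 (nat \<lceil>T\<rceil>)"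
  define s where "s = \<tau> (r n)"
  have "real n \<le> real (r n)" using seq_suble[OF r] by simp
  then have s: "T \<le> s" using \<tau>(1)[of "r n"] unfolding s_def n_def by linarith
  have "V (z (s + \<delta>)) \<le> V (z s) - D q / 2 * (s + \<delta> - s)"
  proof (rule V_decreases[OF sol])
    fix t assume t: "s \<le> t" "t \<le> s + \<delta>"
    have "norm (z t - z s) \<le> M * \<bar>t - s\<bar>"
      using K M s t T by (intro ode_solution_lipschitz[OF sol]) auto
    also have "\<dots> \<le> M * \<delta>" using t M by (intro mult_left_mono) auto
    finally have "dist (z t) (z s) \<le> \<rho> / 2" using \<delta> by (simp add: dist_norm)
    moreover have "dist (z s) q < \<rho> / 2" unfolding s_def by (rule N0) (simp add: n_def)
    ultimately have "dist (z t) q < \<rho>" using dist_triangle[of "z t" q "z s"] by linarith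
    then show "D q / 2 \<le> D (z t)" using \<rho>(2) by (simp add: less_imp_le)
  qed (use s T \<delta> in auto)
  moreover have "V (z s) \<le> V (z T)" using s T by (intro V_nonincreasing[OF sol]) auto
  moreover have "v \<le> V (z (s + \<delta>))" using s T \<delta> by (intro v) auto
  ultimately show False using T by simp
qed

text \<open>If \<open>V y = V ze\<close> for a nearby \<open>y\<close>, then \<open>V\<close> cannot drop along a trajectory from \<open>y\<close>, which forces
  \<open>D y = 0\<close>. So \<open>y\<close> is an equilibrium, and its constant trajectory converges to \<open>ze\<close> only if \<open>y = ze\<close>.\<close>

lemma asymptotically_stable_imp_strict_min:
  assumes "asymptotically_stable_equilibrium F ze"
  shows "\<exists>d>0. \<forall>y. y \<noteq> ze \<and> dist y ze < d \<longrightarrow> V ze < V y"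
proof -
  from assms obtain d where d: "d > 0"
    and attract: "\<And>z J. trajectory F z J \<Longrightarrow> dist (z 0) ze < d \<Longrightarrow> (z \<longlongrightarrow> ze) at_top"
    unfolding asymptotically_stable_equilibrium_def by blast
  have "V ze < V y" if y: "y \<noteq> ze" "dist y ze < d" for y
  proof -
    obtain z J where z: "trajectory F z J" "z 0 = y" using trajectory_exists by blast
    have sol: "ode_solution F z {0..}"
      using z trajectory_complete by (auto simp: trajectory_def)
    have "(z \<longlongrightarrow> ze) at_top" using attract z y by blast
    then have lim: "((\<lambda>t. V (z t)) \<longlongrightarrow> V ze) at_top"
      using continuous_on_tendsto_compose[OF cont_V[of UNIV]] by auto
    have above: "V ze \<le> V (z s)" if "s \<ge> 0" for s
    proof (rule tendsto_upperbound[OF lim])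
      show "\<forall>\<^sub>F t in at_top. V (z t) \<le> V (z s)"
        using eventually_ge_at_top[of s]
        by eventually_elim (use that in \<open>auto intro!: V_nonincreasing[OF sol]\<close>)
    qed simp
    have "V ze \<noteq> V y"
    proof
      assume eq: "V ze = V y"
      have "D y = 0"
      proof (rule ccontr)
        assume "D y \<noteq> 0"
        then have Dy: "D y > 0" using D_nonneg[of y] by simp
        have "continuous_on {0..} (\<lambda>t. D (z t))"
          by (rule continuous_on_compose2[OF cont_D ode_solution_continuous_on[OF sol]]) simp
        then obtain \<delta> where \<delta>: "\<delta> > 0" "\<And>t. t \<ge> 0 \<Longrightarrow> dist t 0 < \<delta> \<Longrightarrow> dist (D (z t)) (D y) < D y / 2"
          unfolding continuous_on_iff using Dy z(2) by (metis atLeast_iff half_gt_zero order_refl)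
        have "V (z (\<delta> / 2)) \<le> V (z 0) - D y / 2 * (\<delta> / 2 - 0)"
        proof (rule V_decreases[OF sol])
          fix t assume "0 \<le> t" "t \<le> \<delta> / 2"
          then have "dist (D (z t)) (D y) < D y / 2" using \<delta> by (intro \<delta>(2)) auto
          then show "D y / 2 \<le> D (z t)" unfolding dist_real_def by linarith
        qed (use \<delta> in auto)
        moreover have "D y / 2 * (\<delta> / 2) > 0" using Dy \<delta> by simp
        ultimately show False using above[of "\<delta> / 2"] \<delta> eq z(2) by simp
      qed
      then have "ode_solution F (\<lambda>t. y) {0..}"
        using D_zero by (auto simp: ode_solution_def is_interval_ci intro!: derivative_eq_intros)
      then have "trajectory F (\<lambda>t. y) {0..}" by (auto simp: trajectory_def ode_solution_def)
      then have "((\<lambda>t::real. y) \<longlongrightarrow> ze) at_top" using attract y by blast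
      then show False using y(1) by (simp add: tendsto_const_iff)
    qed
    then show ?thesis using above[of 0] z(2) by simp
  qed
  then show ?thesis using d by blast
qed

text \<open>A trajectory that leaves the ball crosses its sphere, where \<open>V\<close> is at least some \<open>m > V ze\<close>; it cannot do
  so if it starts where \<open>V < m\<close>.\<close>

lemma strict_min_imp_stable:
  assumes eq: "F ze = 0" and e: "e > 0" "\<And>y. y \<noteq> ze \<Longrightarrow> dist y ze < e \<Longrightarrow> V ze < V y"
  shows "stable_equilibrium F ze"
  unfolding stable_equilibrium_def
proof (intro conjI allI impI eq)
  fix \<epsilon> :: real assume \<epsilon>: "\<epsilon> > 0"
  define r where "r = min \<epsilon> (e / 2)"
  have r: "r > 0" "r \<le> \<epsilon>" "r < e" using \<epsilon> e by (auto simp: r_def)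
  have "\<exists>m > V ze. \<forall>p\<in>sphere ze r. m \<le> V p"
  proof -
    have "sphere ze r \<noteq> {}" using r by simp
    then obtain p where p: "p \<in> sphere ze r" "\<forall>y\<in>sphere ze r. V p \<le> V y"
      using continuous_attains_inf[OF compact_sphere _ cont_V] by blast
    then have "V ze < V p" using r by (intro e(2)) (auto simp: dist_commute)
    then show ?thesis using p by blast
  qed
  then obtain m where m: "m > V ze" "\<And>p. dist ze p = r \<Longrightarrow> m \<le> V p" by auto
  have "isCont V ze" using cont_V[of UNIV] by (simp add: continuous_on_eq_continuous_at)
  then have "\<forall>\<^sub>F y in nhds ze. V y < m"
    using m by (intro order_tendstoD(2)) (auto simp: isCont_def tendsto_at_iff_tendsto_nhds)
  then obtain d where d: "d > 0" "\<And>y. dist y ze < d \<Longrightarrow> V y < m"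
    unfolding eventually_nhds_metric by blast
  show "\<exists>d>0. \<forall>z J. trajectory F z J \<and> dist (z 0) ze < d \<longrightarrow> (\<forall>t\<in>J. dist (z t) ze < \<epsilon>)"
  proof (intro exI[of _ "min d r"] conjI allI impI ballI)
    show "0 < min d r" using d r by simp
    fix z J t assume z: "trajectory F z J \<and> dist (z 0) ze < min d r" and t: "t \<in> J"
    have sol: "ode_solution F z J" using z by (simp add: trajectory_def)
    have t0: "0 \<le> t" and sub: "{0..t} \<subseteq> J"
      using sol t ode_solution_interval[OF sol _ t] by (auto simp: ode_solution_def)
    show "dist (z t) ze < \<epsilon>"
    proof (rule ccontr)
      assume "\<not> dist (z t) ze < \<epsilon>"
      then have "r \<le> dist (z t) ze" using r by simp
      moreover have "continuous_on {0..t} (\<lambda>s. dist (z s) ze)"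
        by (intro continuous_on_dist continuous_on_const continuous_on_subset[OF _ sub]
            ode_solution_continuous_on[OF sol])
      ultimately obtain s where s: "0 \<le> s" "s \<le> t" "dist (z s) ze = r"
        using IVT'[of "\<lambda>s. dist (z s) ze" 0 r t] z t0 by auto
      have "m \<le> V (z s)" using s by (intro m(2)) (simp add: dist_commute)
      also have "\<dots> \<le> V (z 0)" using s sub by (intro trajectory_in_sublevel[OF sol]) auto
      also have "\<dots> < m" using z by (intro d(2)) auto
      finally show False by simp
    qed
  qed
qed

end

section \<open>The closed loop\<close>

text \<open>With \<open>w = A g\<close>, the form at \<open>g - t w\<close> is nonnegative and at most \<open>g \<bullet> w - 2 t (w \<bullet> w) + t\<^sup>2 k (w \<bullet> w)\<close>;
  the best choice is \<open>t = 1 / k\<close>.\<close>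

lemma sym_posdef_norm_sq_le:
  fixes A :: "real^'p^'p"
  assumes A: "sym_posdef A" and k: "matrix_norm A \<le> k" "k > 0"
  shows "(norm (A *v g))\<^sup>2 \<le> k * (g \<bullet> (A *v g))"
proof -
  define w where "w = A *v g"
  define v where "v = g - (1 / k) *\<^sub>R w"
  have sym: "x \<bullet> (A *v y) = (A *v x) \<bullet> y" for x y
    using A by (metis dot_lmul_matrix sym_posdef_def vector_transpose_matrix)
  have "0 \<le> v \<bullet> (A *v v)"
    using A unfolding sym_posdef_def by (cases "v = 0") (auto simp: less_imp_le)
  also have "\<dots> = g \<bullet> w - 2 / k * (w \<bullet> w) + (1 / k)\<^sup>2 * (w \<bullet> (A *v w))"
    unfolding v_def
    by (simp add: matrix_vector_mult_diff_distrib matrix_vector_mult_scaleR inner_diff_left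
        inner_diff_right sym[of g w] flip: w_def) (simp add: power2_eq_square algebra_simps diff_divide_distrib)
  also have "\<dots> \<le> g \<bullet> w - 2 / k * (w \<bullet> w) + (1 / k)\<^sup>2 * (k * (w \<bullet> w))"
  proof -
    have "norm (A *v w) \<le> matrix_norm A * norm w"
      unfolding matrix_norm_def by (rule onorm) simp
    also have "\<dots> \<le> k * norm w" using k by (intro mult_right_mono) auto
    finally have "norm w * norm (A *v w) \<le> norm w * (k * norm w)"
      by (intro mult_left_mono) auto
    then have "w \<bullet> (A *v w) \<le> k * (w \<bullet> w)"
      using norm_cauchy_schwarz[of w "A *v w"]
      by (simp add: dot_square_norm power2_eq_square ac_simps)
    then show ?thesis by (intro add_left_mono mult_left_mono) auto
  qed
  also have "\<dots> = g \<bullet> w - (w \<bullet> w) / k" using k by (simp add: field_simps power2_eq_square)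
  finally have "(w \<bullet> w) / k \<le> g \<bullet> w" by simp
  then show ?thesis
    using k by (simp add: w_def dot_square_norm pos_divide_le_eq mult.commute)
qed

text \<open>The adjoint form: \<open>HT h u\<close> is the transpose of \<open>w \<mapsto> (\<nabla>h(u) w, w)\<close>, the derivative of \<open>u \<mapsto> (h u, u)\<close>.\<close>

lemma inner_HT: "w \<bullet> HT h u z = (jacobian h (at u) *v w) \<bullet> fst z + w \<bullet> snd z"
  unfolding HT_def case_prod_beta inner_add_right
  by (metis dot_lmul_matrix inner_commute transpose_transpose vector_transpose_matrix)

lemma locally_lipschitz_continuous_on:
  assumes "locally_lipschitz g"
  shows "continuous_on UNIV g"
  unfolding continuous_on_eq_continuous_at[OF open_UNIV]
proof
  fix z
  obtain e M where e: "e > 0" "M-lipschitz_on (cball z e) g"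
    using assms unfolding locally_lipschitz_def by blast
  then have "continuous_on (ball z e) g"
    by (meson ball_subset_cball continuous_on_subset lipschitz_on_continuous_on)
  then show "isCont g z" using e(1) by (simp add: continuous_on_eq_continuous_at)
qed

lemma C1_has_derivative_jacobian:
  fixes h :: "real^'p \<Rightarrow> real^'n"
  assumes "C1 h"
  shows "(h has_derivative (\<lambda>w. jacobian h (at u) *v w)) (at u)"
  using assms jacobian_works unfolding C1_def differentiable_def by blast

lemma C1_continuous_on:
  assumes "C1 g"
  shows "continuous_on S g"
  using assms unfolding C1_def
  by (meson has_derivative_continuous_on has_derivative_at_withinI)

lemma continuous_on_HT:
  fixes h :: "real^'p \<Rightarrow> real^'n"
  assumes h: "C1 h" and u: "continuous_on S u" and z: "continuous_on S z"
  shows "continuous_on S (\<lambda>s. HT h (u s) (z s))"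
proof -
  obtain h' where h': "\<And>u. (h has_derivative blinfun_apply (h' u)) (at u)" "continuous_on UNIV h'"
    using h unfolding C1_def by blast
  have J: "jacobian h (at v) *v w = blinfun_apply (h' v) w" for v w
    using has_derivative_unique[OF C1_has_derivative_jacobian[OF h, of v] h'(1)] by metis
  have "HT h (u s) (z s) = (\<chi> i. blinfun_apply (h' (u s)) (axis i 1) \<bullet> fst (z s) + axis i 1 \<bullet> snd (z s))"
    for s
    unfolding vec_eq_iff using inner_HT[of "axis _ 1" h "u s" "z s"]
    by (simp add: J inner_axis')
  moreover have "continuous_on S (\<lambda>s. h' (u s))"
    by (rule continuous_on_compose2[OF h'(2) u]) simp
  ultimately show ?thesis
    using z by (auto intro!: continuous_intros continuous_on_vec_lambda)
qed

lemma continuous_on_matrix_vector_mult: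
  fixes A :: "'a::topological_space \<Rightarrow> real^'n^'m"
  assumes "continuous_on S A" "continuous_on S g"
  shows "continuous_on S (\<lambda>s. A s *v g s)"
proof -
  have "A s *v g s = (\<chi> i. A s $ i \<bullet> g s)" for s
    by (simp add: vec_eq_iff matrix_vector_mul_component)
  then show ?thesis using assms by (auto intro!: continuous_intros continuous_on_vec_lambda)
qed

lemma C1_has_derivative_gradient:
  fixes \<Phi> :: "'a::euclidean_space \<Rightarrow> real"
  assumes "C1 \<Phi>"
  shows "(\<Phi> has_derivative (\<lambda>v. v \<bullet> gradient \<Phi> z)) (at z)"
  using GDERIV_gradient[of \<Phi> z] assms unfolding C1_def differentiable_def gderiv_def by blast

lemma reduced_cost_has_derivative:
  fixes h :: "real^'p \<Rightarrow> real^'n"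
  assumes "C1 h" "C1 \<Phi>"
  shows "((\<lambda>u. \<Phi> (h u, u)) has_derivative (\<lambda>w. w \<bullet> HT h u (gradient \<Phi> (h u, u)))) (at u)"
proof -
  have "((\<lambda>u. (h u, u)) has_derivative (\<lambda>w. (jacobian h (at u) *v w, w))) (at u)"
    by (intro has_derivative_Pair has_derivative_ident C1_has_derivative_jacobian assms)
  from has_derivative_compose[OF this C1_has_derivative_gradient[OF assms(2)]]
  show ?thesis by (simp add: inner_HT inner_prod_def)
qed

text \<open>The weights \<open>\<zeta>\<close> and \<open>L\<close> give both interaction terms \<open>L e q\<close> (from \<open>\<Phi>\<close>) and \<open>\<zeta> e q\<close> (from \<open>W\<close>) the same
  coefficient \<open>\<zeta> L\<close>; this choice yields the largest admissible bound on \<open>Q\<close>.\<close>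

definition closed_loop_lyapunov ::
  "(real^'p \<Rightarrow> real^'n) \<Rightarrow> ((real^'n) \<times> (real^'p) \<Rightarrow> real) \<Rightarrow> ((real^'n) \<times> (real^'p) \<Rightarrow> real) \<Rightarrow>
   real \<Rightarrow> real \<Rightarrow> (real^'n) \<times> (real^'p) \<Rightarrow> real" where
  "closed_loop_lyapunov h \<Phi> W \<zeta> L z = \<zeta> * \<Phi> (h (snd z), snd z) + L * W z"

text \<open>Expanded, this is the quadratic form \<open>(\<zeta>/\<kappa>) q\<^sup>2 - 2 \<zeta> L e q + L \<gamma> e\<^sup>2\<close> delivered by the decay
  estimates; the completed square shows that it is positive definite for \<open>\<kappa> \<zeta> L < \<gamma>\<close>.\<close>

definition dissipation ::
  "(real^'p \<Rightarrow> real^'n) \<Rightarrow> ((real^'n) \<times> (real^'p) \<Rightarrow> real) \<Rightarrow> (real^'p \<Rightarrow> real^'p^'p) \<Rightarrow>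
   real \<Rightarrow> real \<Rightarrow> real \<Rightarrow> real \<Rightarrow> (real^'n) \<times> (real^'p) \<Rightarrow> real" where
  "dissipation h \<Phi> Q \<gamma> \<zeta> L \<kappa> z =
     (let e = norm (fst z - h (snd z)); q = norm (Q (snd z) *v HT h (snd z) (gradient \<Phi> z))
      in \<zeta> / \<kappa> * (q - \<kappa> * L * e)\<^sup>2 + L * (\<gamma> - \<kappa> * \<zeta> * L) * e\<^sup>2)"

lemma dissipation_zeroD:
  assumes "dissipation h \<Phi> Q \<gamma> \<zeta> L \<kappa> (x, u) = 0"
    and pos: "\<zeta> > 0" "L > 0" "\<kappa> > 0" "\<kappa> * \<zeta> * L < \<gamma>"
  shows "x = h u" "Q u *v HT h u (gradient \<Phi> (x, u)) = 0"
proof -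
  let ?e = "norm (x - h u)" and ?q = "norm (Q u *v HT h u (gradient \<Phi> (x, u)))"
  have "\<zeta> / \<kappa> * (?q - \<kappa> * L * ?e)\<^sup>2 + L * (\<gamma> - \<kappa> * \<zeta> * L) * ?e\<^sup>2 = 0"
    using assms(1) by (simp add: dissipation_def Let_def)
  moreover have "0 \<le> \<zeta> / \<kappa> * (?q - \<kappa> * L * ?e)\<^sup>2" "0 \<le> L * (\<gamma> - \<kappa> * \<zeta> * L) * ?e\<^sup>2"
    using pos by auto
  ultimately have *: "\<zeta> / \<kappa> * (?q - \<kappa> * L * ?e)\<^sup>2 = 0" "L * (\<gamma> - \<kappa> * \<zeta> * L) * ?e\<^sup>2 = 0"
    by linarith+
  from *(2) have e: "?e = 0" using pos by simp
  then show "x = h u" by simp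
  have "(?q - \<kappa> * L * ?e)\<^sup>2 = 0" using *(1) pos by simp
  then show "Q u *v HT h u (gradient \<Phi> (x, u)) = 0" using e by simp
qed

text \<open>Decay is the completion of the square explained in the introduction. Sublevel sets are bounded because the reduced cost and
  \<open>W\<close> are both bounded below: a bound on \<open>V\<close> confines \<open>u\<close> to a level set of the reduced cost and, through
  the lower bound on \<open>W\<close>, bounds the distance of \<open>x\<close> from \<open>h u\<close>.\<close>

lemma closed_loop_strict_lyapunov:
  fixes f :: "(real^'n) \<times> (real^'p) \<Rightarrow> real^'n"
  assumes f: "C1 f" and h: "C1 h" and steady: "\<And>u. f (h u, u) = 0"
    and \<Phi>: "C1 \<Phi>" "locally_lipschitz (gradient \<Phi>)"
    and Q: "\<And>u. sym_posdef (Q u)" "locally_lipschitz Q"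
    and L: "L > 0"
      "\<And>x x' u. norm (HT h u (gradient \<Phi> (x', u) - gradient \<Phi> (x, u))) \<le> L * norm (x' - x)"
    and W: "plant_lyapunov f h W \<alpha> \<beta> \<gamma> \<zeta>"
    and level: "compact_level_sets (\<lambda>u. \<Phi> (h u, u))"
    and \<kappa>: "\<kappa> > 0" "\<And>u. matrix_norm (Q u) \<le> \<kappa>" "\<kappa> * \<zeta> * L < \<gamma>"
  shows "strict_lyapunov (closed_loop f h \<Phi> Q) (closed_loop_lyapunov h \<Phi> W \<zeta> L)
    (\<lambda>z v. \<zeta> * (snd v \<bullet> HT h (snd z) (gradient \<Phi> (h (snd z), snd z))) + L * (v \<bullet> gradient W z))
    (dissipation h \<Phi> Q \<gamma> \<zeta> L \<kappa>)"
proof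
  have pos: "\<alpha> > 0" "\<beta> > 0" "\<gamma> > 0" "\<zeta> > 0" and W_diff: "\<And>z. W differentiable (at z)"
    and W_low: "\<And>x u. \<alpha> * (norm (x - h u))\<^sup>2 \<le> W (x, u)"
    and W_x: "\<And>x u. fst (gradient W (x, u)) \<bullet> f (x, u) \<le> - \<gamma> * (norm (x - h u))\<^sup>2"
    and W_u: "\<And>x u. norm (snd (gradient W (x, u))) \<le> \<zeta> * norm (x - h u)"
    using W by (auto simp: plant_lyapunov_def)
  have cont_h: "continuous_on S h" for S by (rule C1_continuous_on[OF h])
  have cont_hu: "continuous_on S (\<lambda>z::(real^'n) \<times> (real^'p). h (snd z))" for S
    by (intro continuous_on_compose2[OF cont_h[of UNIV]] continuous_intros) auto
  have cont_g: "continuous_on UNIV (\<lambda>z. HT h (snd z) (gradient \<Phi> z))"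
    by (intro continuous_on_HT h locally_lipschitz_continuous_on \<Phi> continuous_intros)
  have cont_Q: "continuous_on UNIV (\<lambda>z::(real^'n) \<times> (real^'p). Q (snd z))"
    by (intro continuous_on_compose2[OF locally_lipschitz_continuous_on[OF Q(2)]] continuous_intros) auto
  note cont_Qg = continuous_on_matrix_vector_mult[OF cont_Q cont_g]
  show "continuous_on UNIV (closed_loop f h \<Phi> Q)"
    unfolding closed_loop_def case_prod_beta prod.collapse
    by (intro continuous_on_Pair continuous_on_minus cont_Qg C1_continuous_on f)
  show "continuous_on UNIV (dissipation h \<Phi> Q \<gamma> \<zeta> L \<kappa>)"
    unfolding dissipation_def[abs_def] Let_def by (intro continuous_intros cont_Qg cont_hu)
  show "0 \<le> dissipation h \<Phi> Q \<gamma> \<zeta> L \<kappa> z" for z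
    using pos L(1) \<kappa> by (simp add: dissipation_def Let_def)
  show "(closed_loop_lyapunov h \<Phi> W \<zeta> L has_derivative
      (\<lambda>v. \<zeta> * (snd v \<bullet> HT h (snd z) (gradient \<Phi> (h (snd z), snd z))) + L * (v \<bullet> gradient W z))) (at z)"
    for z
  proof -
    have "((\<lambda>z. \<Phi> (h (snd z), snd z)) has_derivative
        (\<lambda>v. snd v \<bullet> HT h (snd z) (gradient \<Phi> (h (snd z), snd z)))) (at z)"
      by (rule has_derivative_compose[of snd snd, OF has_derivative_snd[OF has_derivative_ident]
            reduced_cost_has_derivative[OF h \<Phi>(1)]])
    moreover have "(W has_derivative (\<lambda>v. v \<bullet> gradient W z)) (at z)"
      using GDERIV_gradient[OF W_diff] by (simp add: gderiv_def)
    ultimately show ?thesis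
      unfolding closed_loop_lyapunov_def[abs_def]
      by (intro has_derivative_add has_derivative_mult_right)
  qed
  show "\<zeta> * (snd (closed_loop f h \<Phi> Q z) \<bullet> HT h (snd z) (gradient \<Phi> (h (snd z), snd z)))
      + L * (closed_loop f h \<Phi> Q z \<bullet> gradient W z) \<le> - dissipation h \<Phi> Q \<gamma> \<zeta> L \<kappa> z" for z
  proof (cases z)
    case (Pair x u)
    define g where "g = HT h u (gradient \<Phi> (x, u))"
    define g0 where "g0 = HT h u (gradient \<Phi> (h u, u))"
    define w where "w = Q u *v g"
    define e where "e = norm (x - h u)"
    define q where "q = norm w"
    have "g - g0 = HT h u (gradient \<Phi> (x, u) - gradient \<Phi> (h u, u))"
      by (simp add: g_def g0_def HT_def case_prod_beta matrix_vector_mult_diff_distrib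
          del: transpose_matrix_vector)
    then have "norm (g - g0) \<le> L * e" using L(2) by (simp add: e_def)
    then have "w \<bullet> (g - g0) \<le> q * (L * e)"
      using norm_cauchy_schwarz[of w "g - g0"] mult_left_mono[of _ _ q] unfolding q_def
      by (meson norm_ge_zero order_trans)
    moreover have "q\<^sup>2 / \<kappa> \<le> w \<bullet> g"
      using sym_posdef_norm_sq_le[OF Q(1) \<kappa>(2,1), of u g] \<kappa>(1)
      by (simp add: q_def w_def pos_divide_le_eq inner_commute mult.commute)
    ultimately have "- (w \<bullet> g0) \<le> - (q\<^sup>2 / \<kappa>) + q * (L * e)"
      by (simp add: inner_diff_right)
    then have \<Phi>_part: "\<zeta> * - (w \<bullet> g0) \<le> \<zeta> * (- (q\<^sup>2 / \<kappa>) + q * (L * e))"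
      using pos by (intro mult_left_mono) auto
    have "- w \<bullet> snd (gradient W (x, u)) \<le> norm (- w) * norm (snd (gradient W (x, u)))"
      by (rule norm_cauchy_schwarz)
    also have "\<dots> \<le> q * (\<zeta> * e)"
      unfolding q_def e_def norm_minus_cancel using W_u by (intro mult_left_mono) auto
    finally have "f (x, u) \<bullet> fst (gradient W (x, u)) - w \<bullet> snd (gradient W (x, u))
        \<le> - \<gamma> * e\<^sup>2 + q * (\<zeta> * e)"
      using W_x[of x u] by (simp add: e_def inner_commute)
    then have W_part: "L * (f (x, u) \<bullet> fst (gradient W (x, u)) - w \<bullet> snd (gradient W (x, u)))
        \<le> L * (- \<gamma> * e\<^sup>2 + q * (\<zeta> * e))"
      using L(1) by (intro mult_left_mono) auto
    have "\<zeta> * (- (q\<^sup>2 / \<kappa>) + q * (L * e)) + L * (- \<gamma> * e\<^sup>2 + q * (\<zeta> * e))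
        = - (\<zeta> / \<kappa> * (q - \<kappa> * L * e)\<^sup>2 + L * (\<gamma> - \<kappa> * \<zeta> * L) * e\<^sup>2)"
      using \<kappa>(1) by (simp add: field_simps power2_eq_square)
    then show ?thesis
      using \<Phi>_part W_part
      by (simp add: Pair closed_loop_def dissipation_def Let_def inner_prod_def
          flip: g_def g0_def w_def e_def q_def)
  qed
  show "closed_loop f h \<Phi> Q z = 0" if "dissipation h \<Phi> Q \<gamma> \<zeta> L \<kappa> z = 0" for z
  proof (cases z)
    case (Pair x u)
    then show ?thesis
      using dissipation_zeroD[of h \<Phi> Q \<gamma> \<zeta> L \<kappa> x u] that pos L(1) \<kappa>(1,3) steady
      by (simp add: closed_loop_def zero_prod_def)
  qed
  show "bounded {z. closed_loop_lyapunov h \<Phi> W \<zeta> L z \<le> c}" for c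
  proof -
    have cont_red: "continuous_on UNIV (\<lambda>u. \<Phi> (h u, u))"
      by (rule has_derivative_continuous_on, rule has_derivative_at_withinI)
        (rule reduced_cost_has_derivative[OF h \<Phi>(1)])
    have comp: "compact {u. \<Phi> (h u, u) \<le> a}" for a
      using level by (simp add: compact_level_sets_def)
    obtain b where "b \<in> {u. \<Phi> (h u, u) \<le> \<Phi> (h 0, 0)}"
      "\<forall>u\<in>{u. \<Phi> (h u, u) \<le> \<Phi> (h 0, 0)}. \<Phi> (h b, b) \<le> \<Phi> (h u, u)"
      using continuous_attains_inf[OF comp[of "\<Phi> (h 0, 0)"] _ continuous_on_subset[OF cont_red subset_UNIV]]
      by blast
    then have b: "\<Phi> (h b, b) \<le> \<Phi> (h u, u)" for u
      by (cases "\<Phi> (h u, u) \<le> \<Phi> (h 0, 0)") auto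
    define U where "U = {u. \<Phi> (h u, u) \<le> c / \<zeta>}"
    define r where "r = sqrt ((c - \<zeta> * \<Phi> (h b, b)) / (L * \<alpha>))"
    have "compact U" unfolding U_def by (rule comp)
    then have "bounded U" "bounded (h ` U)"
      using compact_imp_bounded compact_continuous_image cont_h by blast+
    then obtain B C where B: "\<And>u. u \<in> U \<Longrightarrow> norm u \<le> B" and C: "\<And>u. u \<in> U \<Longrightarrow> norm (h u) \<le> C"
      unfolding bounded_iff by (metis imageI)
    have "norm z \<le> (r + C) + B" if z: "closed_loop_lyapunov h \<Phi> W \<zeta> L z \<le> c" for z
    proof (cases z)
      case (Pair x u)
      have low: "L * (\<alpha> * (norm (x - h u))\<^sup>2) \<le> L * W (x, u)"
        using W_low L(1) by (intro mult_left_mono) auto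
      have V: "\<zeta> * \<Phi> (h u, u) + L * W (x, u) \<le> c" using z Pair by (simp add: closed_loop_lyapunov_def)
      have "0 \<le> L * (\<alpha> * (norm (x - h u))\<^sup>2)" using L(1) pos by simp
      then have "\<zeta> * \<Phi> (h u, u) \<le> c" using V low by linarith
      then have u: "u \<in> U" using pos by (simp add: U_def pos_le_divide_eq mult.commute)
      have "\<zeta> * \<Phi> (h b, b) \<le> \<zeta> * \<Phi> (h u, u)" using b pos by (intro mult_left_mono) auto
      then have "L * (\<alpha> * (norm (x - h u))\<^sup>2) \<le> c - \<zeta> * \<Phi> (h b, b)" using low V by linarith
      then have "(norm (x - h u))\<^sup>2 \<le> (c - \<zeta> * \<Phi> (h b, b)) / (L * \<alpha>)"
        using L(1) pos by (simp add: pos_le_divide_eq ac_simps)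
      then have "norm (x - h u) \<le> r" unfolding r_def by (rule real_le_rsqrt)
      then have "norm x \<le> r + C" using C[OF u] norm_triangle_ineq2[of x "h u"] by linarith
      moreover have "norm z \<le> norm x + norm u" unfolding Pair by (rule norm_Pair_le)
      ultimately show ?thesis using B[OF u] by linarith
    qed
    then show ?thesis unfolding bounded_iff by blast
  qed
qed

text \<open>The decay of \<open>W\<close> along the plant is strict off the steady-state manifold.\<close>

lemma equilibrium_feasible:
  assumes "plant_lyapunov f h W \<alpha> \<beta> \<gamma> \<zeta>" "f (x, u) = 0"
  shows "x = h u"
proof -
  have "fst (gradient W (x, u)) \<bullet> f (x, u) \<le> - \<gamma> * (norm (x - h u))\<^sup>2" "\<gamma> > 0"
    using assms(1) by (auto simp: plant_lyapunov_def)
  then have "\<gamma> * (norm (x - h u))\<^sup>2 \<le> 0" using assms(2) by simp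
  then show ?thesis using \<open>\<gamma> > 0\<close> by (simp add: mult_le_0_iff)
qed

lemma critical_pointI:
  assumes "x = h u" "HT h u (gradient \<Phi> (x, u)) = 0"
  shows "(x, u) \<in> critical_points \<Phi> h"
proof -
  obtain a b where ab: "gradient \<Phi> (x, u) = (a, b)" by (cases "gradient \<Phi> (x, u)")
  have "transpose (jacobian h (at u)) *v a + b = 0" using assms(2) by (simp add: HT_def ab)
  moreover have "transpose (jacobian h (at u)) *v (- a) = - (transpose (jacobian h (at u)) *v a)"
    by (rule linear_neg[OF matrix_vector_mul_linear])
  \<comment> \<open>The only possible multiplier is minus the \<open>x\<close>-component of the gradient.\<close>
  ultimately have "gradient \<Phi> (x, u) + (- a, - (transpose (jacobian h (at u)) *v (- a))) = 0"
    by (simp add: ab zero_prod_def add.commute)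
  then show ?thesis using assms(1) unfolding critical_points_def by blast
qed

theorem mainTheorem1:
  fixes f :: "(real^'n) \<times> (real^'p) \<Rightarrow> real^'n"
    and h :: "real^'p \<Rightarrow> real^'n"
    and \<Phi> W :: "(real^'n) \<times> (real^'p) \<Rightarrow> real"
    and Q :: "real^'p \<Rightarrow> real^'p^'p"
    and L lx lu l \<alpha> \<beta> \<gamma> \<zeta> :: real
  assumes "plant_assumption f h lx lu l"
    and "C1 \<Phi>" and "locally_lipschitz (gradient \<Phi>)"
    and "\<forall>u. sym_posdef (Q u)" and "locally_lipschitz Q"
    and "L > 0"
    and "\<forall>x x' u. norm (HT h u (gradient \<Phi> (x', u) - gradient \<Phi> (x, u))) \<le> L * norm (x' - x)"
    and "plant_lyapunov f h W \<alpha> \<beta> \<gamma> \<zeta>"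
    and "compact_level_sets (\<lambda>u. \<Phi> (h u, u))"
    and "bdd_above (range (\<lambda>u. matrix_norm (Q u)))"
    and "(SUP u. matrix_norm (Q u)) < \<gamma> / (\<zeta> * L)"
  shows "(\<forall>z J. trajectory (closed_loop f h \<Phi> Q) z J \<longrightarrow>
            J = {0..} \<and> converges_to_set z (critical_points \<Phi> h)) \<and>
         (\<forall>ze. asymptotically_stable_equilibrium (closed_loop f h \<Phi> Q) ze \<longrightarrow>
            strict_local_minimizer \<Phi> (feasible_set h) ze) \<and>
         (\<forall>ze. strict_local_minimizer \<Phi> (feasible_set h) ze \<longrightarrow>
            stable_equilibrium (closed_loop f h \<Phi> Q) ze)"
proof -
  have f: "C1 f" and h: "C1 h" and steady: "\<And>u. f (h u, u) = 0"
    using assms(1) by (auto simp: plant_assumption_def)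
  have pos: "\<alpha> > 0" "\<gamma> > 0" "\<zeta> > 0"
    and W_low: "\<And>x u. \<alpha> * (norm (x - h u))\<^sup>2 \<le> W (x, u)"
    and W_high: "\<And>x u. W (x, u) \<le> \<beta> * (norm (x - h u))\<^sup>2"
    using assms(8) by (auto simp: plant_lyapunov_def)
  define B where "B = \<gamma> / (\<zeta> * L)"
  \<comment> \<open>The maximum with \<open>B / 2\<close> makes \<open>\<kappa>\<close> visibly positive and keeps it below \<open>B\<close>.\<close>
  define \<kappa> where "\<kappa> = max (SUP u. matrix_norm (Q u)) (B / 2)"
  have "B > 0" using pos assms(6) by (simp add: B_def)
  then have "B / 2 > 0" "B / 2 < B" by auto
  then have \<kappa>: "\<kappa> > 0" "\<kappa> < B"
    using assms(11) by (auto simp: \<kappa>_def less_max_iff_disj simp flip: B_def)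
  have \<kappa>L: "\<kappa> * \<zeta> * L < \<gamma>"
    using \<kappa>(2) pos assms(6) unfolding B_def by (simp add: pos_less_divide_eq mult.assoc)
  have Q\<kappa>: "matrix_norm (Q u) \<le> \<kappa>" for u
    unfolding \<kappa>_def using cSUP_upper[OF UNIV_I assms(10), of u] by simp
  let ?F = "closed_loop f h \<Phi> Q"
  define V where "V = closed_loop_lyapunov h \<Phi> W \<zeta> L"
  interpret strict_lyapunov ?F V
    "\<lambda>z v. \<zeta> * (snd v \<bullet> HT h (snd z) (gradient \<Phi> (h (snd z), snd z))) + L * (v \<bullet> gradient W z)"
    "dissipation h \<Phi> Q \<gamma> \<zeta> L \<kappa>"
    unfolding V_def
    by (rule closed_loop_strict_lyapunov[OF f h steady assms(2,3) _ assms(5,6) _ assms(8,9) \<kappa>(1) Q\<kappa> \<kappa>L])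
      (use assms(4,7) in auto)
  have V_above: "\<zeta> * \<Phi> (h u, u) + L * (\<alpha> * (norm (x - h u))\<^sup>2) \<le> V (x, u)" for x u
    using W_low[where x=x and u=u] assms(6) by (simp add: V_def closed_loop_lyapunov_def)
  have V_feasible: "V (h u, u) = \<zeta> * \<Phi> (h u, u)" for u
    using W_low[where x="h u" and u=u] W_high[where x="h u" and u=u]
    by (simp add: V_def closed_loop_lyapunov_def)
  have critical: "z \<in> critical_points \<Phi> h" if "dissipation h \<Phi> Q \<gamma> \<zeta> L \<kappa> z = 0" for z
  proof (cases z)
    case (Pair x u)
    let ?g = "HT h u (gradient \<Phi> (x, u))"
    have "x = h u" "Q u *v ?g = 0"
      using dissipation_zeroD[of h \<Phi> Q \<gamma> \<zeta> L \<kappa> x u] that Pair pos assms(6) \<kappa>(1) \<kappa>L by auto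
    moreover have "?g = 0"
    proof (rule ccontr)
      assume "?g \<noteq> 0"
      then have "?g \<bullet> (Q u *v ?g) > 0" using assms(4) by (auto simp: sym_posdef_def)
      then show False using \<open>Q u *v ?g = 0\<close> by simp
    qed
    ultimately show ?thesis unfolding Pair by (blast intro: critical_pointI)
  qed
  have "converges_to_set z (critical_points \<Phi> h)" if "trajectory ?F z J" for z J
    using trajectory_converges[OF that] critical
    unfolding converges_to_set_def by (fast elim!: eventually_mono)
  moreover have "strict_local_minimizer \<Phi> (feasible_set h) ze"
    if as: "asymptotically_stable_equilibrium ?F ze" for ze
  proof (cases ze)
    case (Pair x0 u0)
    have "?F ze = 0"
      using as by (simp add: asymptotically_stable_equilibrium_def stable_equilibrium_def)
    then have x0: "x0 = h u0"
      using equilibrium_feasible[OF assms(8)] by (simp add: Pair closed_loop_def zero_prod_def)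
    obtain d where d: "d > 0" "\<And>y. y \<noteq> ze \<Longrightarrow> dist y ze < d \<Longrightarrow> V ze < V y"
      using asymptotically_stable_imp_strict_min[OF as] by blast
    have "\<Phi> ze < \<Phi> y" if y: "y \<in> feasible_set h" "y \<noteq> ze" "dist y ze < d" for y
    proof -
      obtain u where u: "y = (h u, u)" using y(1) by (auto simp: feasible_set_def)
      have "V ze < V y" using d y by blast
      then show ?thesis using pos by (simp add: u Pair x0 V_feasible)
    qed
    then show ?thesis using d(1) x0 unfolding strict_local_minimizer_def
      by (auto simp: feasible_set_def Pair)
  qed
  moreover have "stable_equilibrium ?F ze"
    if min: "strict_local_minimizer \<Phi> (feasible_set h) ze" for ze
  proof -
    obtain u0 where ze: "ze = (h u0, u0)"
      using min by (auto simp: strict_local_minimizer_def feasible_set_def)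
    obtain e where e: "e > 0" "\<And>u. u \<noteq> u0 \<Longrightarrow> dist (h u, u) ze < e \<Longrightarrow> \<Phi> ze < \<Phi> (h u, u)"
      using min unfolding strict_local_minimizer_def feasible_set_def ze by auto
    define S where "S = {u. dist (h u, u) ze < e}"
    have "open S" unfolding S_def
      by (intro open_Collect_less continuous_intros C1_continuous_on h)
    have "u0 \<in> S" using e(1) by (simp add: S_def ze)
    have S_min: "\<Phi> (h u0, u0) \<le> \<Phi> (h u, u)" if "u \<in> S" for u
      using e(2)[of u] that by (cases "u = u0") (auto simp: S_def ze)
    have "(\<lambda>w. w \<bullet> HT h u0 (gradient \<Phi> (h u0, u0))) = (\<lambda>w. 0)"
      using differential_zero_maxmin[OF \<open>u0 \<in> S\<close> \<open>open S\<close> reduced_cost_has_derivative[OF h assms(2)]]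
        S_min by blast
    then have "HT h u0 (gradient \<Phi> (h u0, u0)) = 0" by (metis inner_eq_zero_iff)
    then have eq: "?F ze = 0" by (simp add: ze closed_loop_def steady zero_prod_def)
    obtain d where d: "d > 0" "ball u0 d \<subseteq> S"
      using \<open>open S\<close> \<open>u0 \<in> S\<close> open_contains_ball by blast
    show ?thesis
    proof (rule strict_min_imp_stable[OF eq d(1)])
      fix y assume y: "y \<noteq> ze" "dist y ze < d"
      obtain x u where y_def: "y = (x, u)" by (cases y)
      have "dist u u0 < d" using dist_snd_le[of y ze] y by (simp add: y_def ze)
      then have u: "u \<in> S" using d(2) by (auto simp: dist_commute)
      have ge: "\<zeta> * \<Phi> (h u0, u0) \<le> \<zeta> * \<Phi> (h u, u)"
        using S_min[OF u] pos by simp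
      show "V ze < V y"
      proof (cases "x = h u")
        case True
        then have "u \<noteq> u0" using y y_def ze by auto
        then have "\<Phi> ze < \<Phi> (h u, u)" using e(2) u by (simp add: S_def)
        then show ?thesis using pos by (simp add: y_def True ze V_feasible)
      next
        case False
        then have "0 < L * (\<alpha> * (norm (x - h u))\<^sup>2)" using pos assms(6) by simp
        then show ?thesis using ge V_above[of u x] by (simp add: y_def ze V_feasible)
      qed
    qed
  qed
  ultimately show ?thesis using trajectory_complete by blast
qed

end
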